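(* Let $G$ be a discrete group acting faithfully by homeomorphisms on a compact Hausdorff space $X$. Suppose that there is a basis $\mathcal{I}$ of the topology of $X$ consisting of non-dense and non-empty open sets such that the following hold: (1) (Complements) For every $I\in\mathcal{I}$ there exists $J\in\mathcal{I}$ such that $X\setminus I\subset J$. (2) (Double transitivity) $G$ preserves $\mathcal{I}$, and for every two pairs $(I,J),(I',J')\in\mathcal{I}^{(2)}$ there exists $g\in G$ such that $(gI,gJ)=(I',J')$. (3) (Weak triple transitivity) For every $g,h\in G$ there exists $(M,N,P)\in\mathcal{I}^{(3)}$ such that $(M,N,P)$ and $(gM,hN,P)$ are in the same $G$-orbit in $\mathcal{I}^{(3)}$. (4) (Local action) For every $(I,J,K)\in\mathcal{I}^{(3)}$ and all $g,h\in G$ with $gI=I$ and $hJ=J$, there exists $b\in G$ such that $b|_I=g|_I$, $b|_J=h|_J$ and $b|_K=\mathrm{id}|_K$. Then $G$ has Property (NGT).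
   Context: For a collection $\mathcal{I}$ of subsets of $X$, $\mathcal{I}^{(n)}$ denotes the set of ordered $n$-tuples of elements of $\mathcal{I}$ whose closures are pairwise disjoint and whose union is not dense in $X$. A hyperbolic space is a geodesic Gromov hyperbolic metric space $Y$ (not necessarily proper), with Gromov boundary $\partial Y$; actions on hyperbolic spaces are by isometries. For an action of $G$ on $Y$, the limit set $\Lambda(G)$ is the set of accumulation points in $\partial Y$ of a $G$-orbit in $Y$. The action is of general type if $\Lambda(G)$ is infinite and $G$ fixes no point of $\partial Y$ (equivalently, $G$ contains two loxodromic elements with no common fixed point in $\partial Y$). A group has Property (NGT) if it admits no action of general type on a hyperbolic space. *)

theory Defs
  imports "HOL-Analysis.Analysis" "HOL-Algebra.Group_Action"
begin

definition disjoint_tuples :: "'x topology \<Rightarrow> 'x set set \<Rightarrow> nat \<Rightarrow> 'x set list set" where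
  "disjoint_tuples X \<I> n =
     {Is. length Is = n \<and> set Is \<subseteq> \<I> \<and>
          (\<forall>i<n. \<forall>j<n. i \<noteq> j \<longrightarrow> disjnt (X closure_of (Is ! i)) (X closure_of (Is ! j))) \<and>
          X closure_of (\<Union>(set Is)) \<noteq> topspace X}"

definition geodesic_space :: "'y set \<Rightarrow> ('y \<Rightarrow> 'y \<Rightarrow> real) \<Rightarrow> bool" where
  "geodesic_space M d \<longleftrightarrow>
     (\<forall>x\<in>M. \<forall>y\<in>M. \<exists>\<gamma>. \<gamma> \<in> {0..d x y} \<rightarrow> M \<and> \<gamma> 0 = x \<and> \<gamma> (d x y) = y \<and>
        (\<forall>s\<in>{0..d x y}. \<forall>t\<in>{0..d x y}. d (\<gamma> s) (\<gamma> t) = \<bar>s - t\<bar>))"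

definition gromov_product :: "('y \<Rightarrow> 'y \<Rightarrow> real) \<Rightarrow> 'y \<Rightarrow> 'y \<Rightarrow> 'y \<Rightarrow> real" where
  "gromov_product d p x y = (d x p + d y p - d x y) / 2"

definition gromov_hyperbolic :: "'y set \<Rightarrow> ('y \<Rightarrow> 'y \<Rightarrow> real) \<Rightarrow> bool" where
  "gromov_hyperbolic M d \<longleftrightarrow>
     (\<exists>\<delta>. \<forall>p\<in>M. \<forall>x\<in>M. \<forall>y\<in>M. \<forall>z\<in>M.
        min (gromov_product d p x y) (gromov_product d p y z) - \<delta> \<le> gromov_product d p x z)"

definition hyperbolic_space :: "'y set \<Rightarrow> ('y \<Rightarrow> 'y \<Rightarrow> real) \<Rightarrow> bool" where
  "hyperbolic_space M d \<longleftrightarrow> Metric_space M d \<and> geodesic_space M d \<and> gromov_hyperbolic M d"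

text \<open>Not assuming properness, the Gromov boundary is defined by sequences rather than by
  geodesic rays. The condition below does not depend on the base point \<open>p\<close>; for \<open>s = t\<close> it says
  that \<open>s\<close> converges to infinity.\<close>

definition asymptotic :: "'y set \<Rightarrow> ('y \<Rightarrow> 'y \<Rightarrow> real) \<Rightarrow> (nat \<Rightarrow> 'y) \<Rightarrow> (nat \<Rightarrow> 'y) \<Rightarrow> bool" where
  "asymptotic M d s t \<longleftrightarrow>
     (\<forall>p\<in>M. filterlim (\<lambda>(i, j). gromov_product d p (s i) (t j)) at_top
              (sequentially \<times>\<^sub>F sequentially))"

definition gromov_sequences :: "'y set \<Rightarrow> ('y \<Rightarrow> 'y \<Rightarrow> real) \<Rightarrow> (nat \<Rightarrow> 'y) set" where
  "gromov_sequences M d = {s. range s \<subseteq> M \<and> asymptotic M d s s}"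

definition gromov_boundary :: "'y set \<Rightarrow> ('y \<Rightarrow> 'y \<Rightarrow> real) \<Rightarrow> (nat \<Rightarrow> 'y) set set" where
  "gromov_boundary M d =
     gromov_sequences M d //
       {(s, t). s \<in> gromov_sequences M d \<and> t \<in> gromov_sequences M d \<and> asymptotic M d s t}"

definition isometric_action ::
  "('g, 'm) monoid_scheme \<Rightarrow> 'y set \<Rightarrow> ('y \<Rightarrow> 'y \<Rightarrow> real) \<Rightarrow> ('g \<Rightarrow> 'y \<Rightarrow> 'y) \<Rightarrow> bool" where
  "isometric_action G M d \<psi> \<longleftrightarrow>
     group_action G M \<psi> \<and>
     (\<forall>g\<in>carrier G. \<forall>x\<in>M. \<forall>y\<in>M. d (\<psi> g x) (\<psi> g y) = d x y)"

definition boundary_map :: "('y \<Rightarrow> 'y) \<Rightarrow> (nat \<Rightarrow> 'y) set \<Rightarrow> (nat \<Rightarrow> 'y) set" where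
  "boundary_map f \<xi> = (\<lambda>s. f \<circ> s) ` \<xi>"

text \<open>A sequence in the space converges to the boundary point \<open>\<xi>\<close> iff it belongs to the class
  \<open>\<xi>\<close>. Two orbits lie within bounded distance of each other, hence have the same accumulation points on
  the boundary, so the choice of \<open>x\<close> is immaterial.\<close>

definition limit_set ::
  "('g, 'm) monoid_scheme \<Rightarrow> 'y set \<Rightarrow> ('y \<Rightarrow> 'y \<Rightarrow> real) \<Rightarrow> ('g \<Rightarrow> 'y \<Rightarrow> 'y) \<Rightarrow> (nat \<Rightarrow> 'y) set set" where
  "limit_set G M d \<psi> =
     {\<xi> \<in> gromov_boundary M d. \<exists>x\<in>M. \<exists>s\<in>\<xi>. range s \<subseteq> orbit G \<psi> x}"

definition general_type ::
  "('g, 'm) monoid_scheme \<Rightarrow> 'y set \<Rightarrow> ('y \<Rightarrow> 'y \<Rightarrow> real) \<Rightarrow> ('g \<Rightarrow> 'y \<Rightarrow> 'y) \<Rightarrow> bool" where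
  "general_type G M d \<psi> \<longleftrightarrow>
     infinite (limit_set G M d \<psi>) \<and>
     \<not> (\<exists>\<xi>\<in>gromov_boundary M d. \<forall>g\<in>carrier G. boundary_map (\<psi> g) \<xi> = \<xi>)"

text \<open>HOL cannot quantify over types inside a definition, so the hyperbolic spaces range over the
  subsets of an arbitrary type \<open>'y\<close>. Property (NGT) is \<open>property_NGT TYPE('y) G\<close> for every
  \<open>'y\<close>; a theorem concluding it must leave \<open>'y\<close> a free type variable.\<close>

definition property_NGT :: "'y itself \<Rightarrow> ('g, 'm) monoid_scheme \<Rightarrow> bool" where
  "property_NGT T G \<longleftrightarrow>
     \<not> (\<exists>(M :: 'y set) d \<psi>.
          hyperbolic_space M d \<and> isometric_action G M d \<psi> \<and> general_type G M d \<psi>)"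

end

theory Submission
  imports Defs
begin

text \<open>
  Write \<open>Fix I\<close> for the pointwise fixer in \<open>G\<close> of a basic open set \<open>I\<close>. An action of \<open>G\<close> on a
  hyperbolic space is controlled by these subgroups. Suppose first that \<open>X\<close> has no isolated point;
  then every basic set belongs to a pair of basic sets with disjoint closures and non-dense union,
  and the fixers have four properties.

  Every element of \<open>G\<close> is a product of an element of \<open>Fix M\<close> and an element of \<open>Fix N\<close> for some
  such pair \<open>(M, N)\<close>: weak triple transitivity and the local action property produce,
  for each \<open>g\<close>, an element that agrees with \<open>g\<close> on \<open>M\<close> and with the identity on \<open>N\<close> (\<open>factorization\<close>). By double transitivity all such pairs \<open>(Fix M, Fix N)\<close> are
  simultaneously conjugate. If \<open>I \<union> J\<close> is the whole space, then \<open>Fix I\<close> and \<open>Fix J\<close> commute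
  (\<open>fixers_commute\<close>), and by complements every \<open>I\<close> has such a \<open>J\<close>. Finally any two fixers are
  joined by a chain of inclusions between fixers (\<open>basis_zigzag\<close>).

  Now let \<open>G\<close> act on a hyperbolic space. All fixers are conjugate, so either all of them have bounded
  orbits or none has.

  If they are bounded, every element of \<open>G\<close> is conjugate into one fixed product \<open>Fix M \<cdot> Fix N\<close>, so
  every element moves some point by at most a constant \<open>R\<close>. The powers of a loxodromic element
  violate this, so \<open>G\<close> contains no loxodromic element; then the orbits of \<open>G\<close> are bounded or \<open>G\<close>
  fixes a boundary point (\<open>unbounded_no_loxodromic\<close>).

  If they are unbounded, each fixer has a nonempty limit set. An element commuting with a subgroup
  fixes its limit set pointwise (\<open>commuting_fixes_limit\<close>), and a group fixing three boundary points
  has bounded orbits (\<open>three_fixed_points_bounded\<close>). Hence the limit sets of the fixers are finite,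
  and by conjugacy all have the same cardinality. An inclusion of fixers therefore gives equality of
  their limit sets, and along the chains of inclusions all fixers have the same limit set
  \<open>\<Lambda>\<close>. Each fixer commutes with another fixer and so fixes \<open>\<Lambda>\<close> pointwise; since the
  fixers generate \<open>G\<close>, so does \<open>G\<close>. In both cases the action is not of general type.

  If \<open>X\<close> has an isolated point, a basic set need not belong to such a pair, and the conjugacy of all
  fixers can fail. Double transitivity then makes every point isolated, so \<open>X\<close> and \<open>G\<close> are finite,
  and a finite group has bounded orbits.
\<close>

section \<open>Gromov products and sequences converging to the boundary\<close>

locale hyperbolic_metric = Metric_space M d for M :: "'y set" and d +
  fixes \<delta> :: real
  assumes \<delta>_nonneg: "0 \<le> \<delta>"
    and four_point: "\<lbrakk>p \<in> M; x \<in> M; y \<in> M; z \<in> M\<rbrakk> \<Longrightarrow>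
      min (gromov_product d p x y) (gromov_product d p y z) - \<delta> \<le> gromov_product d p x z"
begin

abbreviation gp where "gp \<equiv> gromov_product d"

text \<open>
  The definition cleared of its denominator, the form in which linear arithmetic can use it.
\<close>

lemma two_gp: "2 * gp p x y = d x p + d y p - d x y"
  by (simp add: gromov_product_def)

lemma gp_commute: "gp p x y = gp p y x"
  by (simp add: gromov_product_def commute)

lemma gp_le_dist:
  assumes "p \<in> M" "x \<in> M" "y \<in> M"
  shows "gp p x y \<le> d p x"
  using triangle[of y x p] assms commute[of x y] commute[of p x]
  by (simp add: gromov_product_def)

lemma gp_basepoint:
  assumes "p \<in> M" "q \<in> M" "x \<in> M" "y \<in> M"
  shows "gp p x y - d p q \<le> gp q x y"
  using triangle[of x q p] triangle[of y q p] assms commute[of p q]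
  unfolding gromov_product_def by argo

lemma gp_perturb:
  assumes "p \<in> M" "x \<in> M" "y \<in> M" "z \<in> M"
  shows "gp p x y - d y z \<le> gp p x z"
  using triangle[of y z p] triangle[of x y z] triangle[of x z y] commute[of y z] assms
  unfolding gromov_product_def by argo

lemma four_point2:
  assumes "p \<in> M" "w \<in> M" "x \<in> M" "y \<in> M" "z \<in> M"
  shows "min (gp p w x) (min (gp p x y) (gp p y z)) - 2 * \<delta> \<le> gp p w z"
  using four_point[OF assms(1,2,3,5)] four_point[OF assms(1,3,4,5)] \<delta>_nonneg by linarith

text \<open>
  A change of base point from \<open>p\<close> to \<open>q\<close> alters Gromov products by at most \<open>d p q\<close>, so divergence
  can be tested at a single base point.
\<close>

lemma asymptotic_iff:
  assumes p: "p \<in> M" and s: "range s \<subseteq> M" and t: "range t \<subseteq> M"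
  shows "asymptotic M d s t \<longleftrightarrow> (\<forall>C. \<exists>N. \<forall>i\<ge>N. \<forall>j\<ge>N. C \<le> gp p (s i) (t j))"
proof
  assume "asymptotic M d s t"
  then have "filterlim (\<lambda>(i, j). gp p (s i) (t j)) at_top (sequentially \<times>\<^sub>F sequentially)"
    using p by (simp add: asymptotic_def)
  then show "\<forall>C. \<exists>N. \<forall>i\<ge>N. \<forall>j\<ge>N. C \<le> gp p (s i) (t j)"
    unfolding filterlim_at_top eventually_prod_sequentially by fastforce
next
  assume R: "\<forall>C. \<exists>N. \<forall>i\<ge>N. \<forall>j\<ge>N. C \<le> gp p (s i) (t j)"
  show "asymptotic M d s t"
    unfolding asymptotic_def filterlim_at_top eventually_prod_sequentially
  proof (intro ballI allI)
    fix q C assume q: "q \<in> M"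
    obtain N where N: "\<forall>i\<ge>N. \<forall>j\<ge>N. C + d p q \<le> gp p (s i) (t j)" using R by blast
    have "C \<le> gp q (s i) (t j)" if "i \<ge> N" "j \<ge> N" for i j
      using N[rule_format, OF that] gp_basepoint[OF p q, of "s i" "t j"] s t by force
    then show "\<exists>N. \<forall>m\<ge>N. \<forall>n\<ge>N. C \<le> (case (n, m) of (i, j) \<Rightarrow> gp q (s i) (t j))"
      by auto
  qed
qed

lemma asymptotic_sym:
  assumes "asymptotic M d s t" "range s \<subseteq> M" "range t \<subseteq> M"
  shows "asymptotic M d t s"
proof -
  obtain p where p: "p \<in> M" using assms by blast
  show ?thesis using assms unfolding asymptotic_iff[OF p assms(2,3)] asymptotic_iff[OF p assms(3,2)]
    by (metis gp_commute)
qed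

lemma asymptotic_trans:
  assumes st: "asymptotic M d s t" and tu: "asymptotic M d t u"
    and r: "range s \<subseteq> M" "range t \<subseteq> M" "range u \<subseteq> M"
  shows "asymptotic M d s u"
proof -
  obtain p where p: "p \<in> M" using r by blast
  show ?thesis unfolding asymptotic_iff[OF p r(1,3)]
  proof
    fix C
    obtain N1 where N1: "\<forall>i\<ge>N1. \<forall>j\<ge>N1. C + \<delta> \<le> gp p (s i) (t j)"
      using st unfolding asymptotic_iff[OF p r(1,2)] by blast
    obtain N2 where N2: "\<forall>i\<ge>N2. \<forall>j\<ge>N2. C + \<delta> \<le> gp p (t i) (u j)"
      using tu unfolding asymptotic_iff[OF p r(2,3)] by blast
    have "C \<le> gp p (s i) (u j)" if "i \<ge> max N1 N2" "j \<ge> max N1 N2" for i j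
    proof -
      have "C + \<delta> \<le> gp p (s i) (t (max N1 N2))" "C + \<delta> \<le> gp p (t (max N1 N2)) (u j)"
        using N1 N2 that by auto
      moreover have "s i \<in> M" "t (max N1 N2) \<in> M" "u j \<in> M" using r by auto
      ultimately show ?thesis using four_point[of p "s i" "t (max N1 N2)" "u j"] p by linarith
    qed
    then show "\<exists>N. \<forall>i\<ge>N. \<forall>j\<ge>N. C \<le> gp p (s i) (u j)" by blast
  qed
qed

lemma asymptotic_bounded_distance:
  assumes s: "asymptotic M d s s" and r: "range s \<subseteq> M" "range t \<subseteq> M"
    and R: "\<And>i. d (s i) (t i) \<le> R"
  shows "asymptotic M d s t"
proof -
  obtain p where p: "p \<in> M" using r by blast
  show ?thesis unfolding asymptotic_iff[OF p r]
  proof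
    fix C
    obtain N where N: "\<forall>i\<ge>N. \<forall>j\<ge>N. C + R \<le> gp p (s i) (s j)"
      using s unfolding asymptotic_iff[OF p r(1,1)] by blast
    have "C \<le> gp p (s i) (t j)" if "i \<ge> N" "j \<ge> N" for i j
      using N[rule_format, OF that] gp_perturb[OF p, of "s i" "s j" "t j"] R[of j] r by force
    then show "\<exists>N. \<forall>i\<ge>N. \<forall>j\<ge>N. C \<le> gp p (s i) (t j)" by blast
  qed
qed

text \<open>
  A Gromov sequence is eventually close to itself as seen from \<open>p\<close>. If arbitrarily late
  products of two such sequences lie below \<open>C\<close>, hyperbolicity spreads this bound to all late indices, at
  the cost of \<open>2 * \<delta>\<close>.
\<close>

lemma not_asymptotic_bounded:
  assumes p: "p \<in> M" and s: "s \<in> gromov_sequences M d" and t: "t \<in> gromov_sequences M d"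
    and nst: "\<not> asymptotic M d s t"
  obtains C N where "\<And>i j. \<lbrakk>i \<ge> N; j \<ge> N\<rbrakk> \<Longrightarrow> gp p (s i) (t j) \<le> C"
proof -
  have r: "range s \<subseteq> M" "range t \<subseteq> M" and as: "asymptotic M d s s" and at: "asymptotic M d t t"
    using s t by (auto simp: gromov_sequences_def)
  obtain C where C: "\<And>N. \<exists>i\<ge>N. \<exists>j\<ge>N. gp p (s i) (t j) < C"
    using nst unfolding asymptotic_iff[OF p r] by (meson not_le)
  obtain N1 where N1: "\<forall>i\<ge>N1. \<forall>j\<ge>N1. C + 2*\<delta> \<le> gp p (s i) (s j)"
    using as unfolding asymptotic_iff[OF p r(1,1)] by blast
  obtain N2 where N2: "\<forall>i\<ge>N2. \<forall>j\<ge>N2. C + 2*\<delta> \<le> gp p (t i) (t j)"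
    using at unfolding asymptotic_iff[OF p r(2,2)] by blast
  define N where "N = max N1 N2"
  obtain k l where kl: "k \<ge> N" "l \<ge> N" "gp p (s k) (t l) < C" using C by blast
  have "gp p (s i) (t j) \<le> C + 2*\<delta>" if "i \<ge> N" "j \<ge> N" for i j
  proof -
    have "C + 2*\<delta> \<le> gp p (s k) (s i)" "C + 2*\<delta> \<le> gp p (t j) (t l)"
      using N1 N2 kl that by (auto simp: N_def)
    moreover have "s k \<in> M" "s i \<in> M" "t j \<in> M" "t l \<in> M" using r by auto
    ultimately show ?thesis using four_point2[of p "s k" "s i" "t j" "t l"] p kl(3) by linarith
  qed
  then show thesis using that by blast
qed

definition boundary_class where
  "boundary_class s = {t \<in> gromov_sequences M d. asymptotic M d s t}"

lemma boundary_class_in: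
  assumes "s \<in> gromov_sequences M d"
  shows "boundary_class s \<in> gromov_boundary M d" "s \<in> boundary_class s"
proof -
  show "boundary_class s \<in> gromov_boundary M d"
    unfolding gromov_boundary_def
    using assms by (auto simp: boundary_class_def quotient_def)
  show "s \<in> boundary_class s" using assms by (auto simp: boundary_class_def gromov_sequences_def)
qed

lemma boundary_class_eq_iff:
  assumes "s \<in> gromov_sequences M d" "t \<in> gromov_sequences M d"
  shows "boundary_class s = boundary_class t \<longleftrightarrow> asymptotic M d s t"
proof
  assume "boundary_class s = boundary_class t"
  then have "t \<in> boundary_class s" using boundary_class_in(2)[OF assms(2)] by simp
  then show "asymptotic M d s t" by (simp add: boundary_class_def)
next
  assume st: "asymptotic M d s t"
  have r: "range s \<subseteq> M" "range t \<subseteq> M" using assms by (auto simp: gromov_sequences_def)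
  show "boundary_class s = boundary_class t"
    unfolding boundary_class_def
    using asymptotic_trans[OF st _ r] asymptotic_trans[OF asymptotic_sym[OF st r] _ r(2,1)]
    by (auto simp: gromov_sequences_def)
qed

lemma boundary_representative:
  assumes "\<xi> \<in> gromov_boundary M d"
  obtains s where "s \<in> gromov_sequences M d" "\<xi> = boundary_class s"
proof -
  obtain s where s: "s \<in> gromov_sequences M d" 
    and "\<xi> = {(s, t). s \<in> gromov_sequences M d \<and> t \<in> gromov_sequences M d \<and> asymptotic M d s t} `` {s}"
    using assms unfolding gromov_boundary_def by (elim quotientE)
  then have "\<xi> = boundary_class s" by (auto simp: boundary_class_def)
  then show thesis using s that by blast
qed

lemma boundary_class_of_mem:
  assumes "\<xi> \<in> gromov_boundary M d" "s \<in> \<xi>"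
  shows "s \<in> gromov_sequences M d" "\<xi> = boundary_class s"
proof -
  obtain t where t: "t \<in> gromov_sequences M d" "\<xi> = boundary_class t"
    using assms(1) by (rule boundary_representative)
  then show s: "s \<in> gromov_sequences M d" using assms(2) by (simp add: boundary_class_def)
  show "\<xi> = boundary_class s"
    using t assms(2) boundary_class_eq_iff[OF t(1) s] by (simp add: boundary_class_def)
qed

lemma bounded_not_gromov_sequence:
  assumes p: "p \<in> M" and s: "s \<in> gromov_sequences M d" and R: "\<And>i. d p (s i) \<le> R"
  shows False
proof -
  have r: "range s \<subseteq> M" using s by (simp add: gromov_sequences_def)
  obtain N where "\<forall>i\<ge>N. \<forall>j\<ge>N. R + 1 \<le> gp p (s i) (s j)"
    using s asymptotic_iff[OF p r r] by (simp add: gromov_sequences_def) blast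
  then have "R + 1 \<le> gp p (s N) (s N)" by blast
  moreover have "gp p (s N) (s N) \<le> d p (s N)" using gp_le_dist p r by (simp add: image_subset_iff)
  ultimately show False using R[of N] by linarith
qed

text \<open>
  The points from which the three products of \<open>x\<close>, \<open>y\<close>, \<open>z\<close> are small form the quasi-centre of
  that triangle, and this set is bounded. As seen from \<open>p\<close>, the point \<open>q\<close> lies in the
  direction of at most one of the three vertices; the same holds with \<open>p\<close> and \<open>q\<close> exchanged. So some
  vertex \<open>u\<close> lies in neither direction, and \<open>d p q\<close> is the sum of the two small products
  \<open>gp p u q\<close> and \<open>gp q u p\<close>.
\<close>

lemma quasi_centres_close:
  assumes M: "p \<in> M" "q \<in> M" "x \<in> M" "y \<in> M" "z \<in> M"
    and p: "gp p x y \<le> C" "gp p y z \<le> C" "gp p x z \<le> C"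
    and q: "gp q x y \<le> C" "gp q y z \<le> C" "gp q x z \<le> C"
  shows "d p q \<le> 2 * (C + \<delta>)"
proof -
  have sum: "gp p u q + gp q u p = d p q" for u
    unfolding gromov_product_def using commute[of u p] commute[of u q] commute[of p q] by argo
  have *: "min (gp p x q) (gp p y q) \<le> C + \<delta>" "min (gp p y q) (gp p z q) \<le> C + \<delta>"
    "min (gp p x q) (gp p z q) \<le> C + \<delta>"
    using four_point[of p x q y] four_point[of p y q z] four_point[of p x q z] M p
    by (simp_all add: gp_commute[of p q])
  have **: "min (gp q x p) (gp q y p) \<le> C + \<delta>" "min (gp q y p) (gp q z p) \<le> C + \<delta>"
    "min (gp q x p) (gp q z p) \<le> C + \<delta>"
    using four_point[of q x p y] four_point[of q y p z] four_point[of q x p z] M q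
    by (simp_all add: gp_commute[of q p])
  show ?thesis using * ** sum[of x] sum[of y] sum[of z] unfolding min_le_iff_disj by argo
qed

end

section \<open>Isometric actions and the induced action on the boundary\<close>

definition bounded_orbits ::
  "('g, 'm) monoid_scheme \<Rightarrow> 'y set \<Rightarrow> ('y \<Rightarrow> 'y \<Rightarrow> real) \<Rightarrow> ('g \<Rightarrow> 'y \<Rightarrow> 'y) \<Rightarrow> bool" where
  "bounded_orbits G M d \<psi> \<longleftrightarrow> (\<forall>x\<in>M. \<exists>R. \<forall>g\<in>carrier G. d x (\<psi> g x) \<le> R)"

definition conjugate_set :: "('g, 'm) monoid_scheme \<Rightarrow> 'g \<Rightarrow> 'g set \<Rightarrow> 'g set" where
  "conjugate_set G g H = (\<lambda>h. g \<otimes>\<^bsub>G\<^esub> h \<otimes>\<^bsub>G\<^esub> inv\<^bsub>G\<^esub> g) ` H"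

locale hyperbolic_action = hyperbolic_metric M d \<delta> + group_action G M \<psi>
  for M :: "'y set" and d and \<delta> and G :: "('g, 'm) monoid_scheme" (structure) and \<psi> +
  assumes isometry: "\<lbrakk>g \<in> carrier G; x \<in> M; y \<in> M\<rbrakk> \<Longrightarrow> d (\<psi> g x) (\<psi> g y) = d x y"

sublocale hyperbolic_action \<subseteq> grp: group G
  using group_hom group_hom.axioms(1) by auto

context hyperbolic_action
begin

lemma act_closed [simp, intro]: "\<lbrakk>g \<in> carrier G; x \<in> M\<rbrakk> \<Longrightarrow> \<psi> g x \<in> M"
  using element_image by blast

lemma act_one [simp]: "x \<in> M \<Longrightarrow> \<psi> \<one> x = x"
  using id_eq_one by (metis restrict_apply')

lemma act_inv [simp]:
  assumes "g \<in> carrier G" "x \<in> M"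
  shows "\<psi> (inv g) (\<psi> g x) = x" "\<psi> g (\<psi> (inv g) x) = x"
  using composition_rule[of x "inv g" g] composition_rule[of x g "inv g"] assms by auto

lemma isometry_inv:
  assumes "g \<in> carrier G" "x \<in> M" "y \<in> M"
  shows "d x (\<psi> g y) = d (\<psi> (inv g) x) y"
  using isometry[of g "\<psi> (inv g) x" y] assms by simp

lemma isometry_gp:
  assumes "g \<in> carrier G" "p \<in> M" "x \<in> M" "y \<in> M"
  shows "gp (\<psi> g p) (\<psi> g x) (\<psi> g y) = gp p x y"
  using assms by (simp add: gromov_product_def isometry)

lemma act_range: "\<lbrakk>g \<in> carrier G; range s \<subseteq> M\<rbrakk> \<Longrightarrow> range (\<psi> g \<circ> s) \<subseteq> M"
  by auto

lemma act_asymptotic: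
  assumes g: "g \<in> carrier G" and st: "asymptotic M d s t" and r: "range s \<subseteq> M" "range t \<subseteq> M"
  shows "asymptotic M d (\<psi> g \<circ> s) (\<psi> g \<circ> t)"
proof -
  obtain p where p: "p \<in> M" using r by blast
  have "gp (\<psi> g p) ((\<psi> g \<circ> s) i) ((\<psi> g \<circ> t) j) = gp p (s i) (t j)" for i j
    using isometry_gp[OF g p] r by (simp add: image_subset_iff)
  then show ?thesis
    using st unfolding asymptotic_iff[OF p r]
      asymptotic_iff[OF act_closed[OF g p] act_range[OF g r(1)] act_range[OF g r(2)]] by simp
qed

lemma act_gromov_sequence:
  assumes "g \<in> carrier G" "s \<in> gromov_sequences M d"
  shows "\<psi> g \<circ> s \<in> gromov_sequences M d"
  using assms act_asymptotic[of g s s] act_range[of g s] by (simp add: gromov_sequences_def)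

lemma boundary_map_class:
  assumes g: "g \<in> carrier G" and s: "s \<in> gromov_sequences M d"
  shows "boundary_map (\<psi> g) (boundary_class s) = boundary_class (\<psi> g \<circ> s)"
proof
  have rs: "range s \<subseteq> M" using s by (simp add: gromov_sequences_def)
  show "boundary_map (\<psi> g) (boundary_class s) \<subseteq> boundary_class (\<psi> g \<circ> s)"
  proof
    fix u assume "u \<in> boundary_map (\<psi> g) (boundary_class s)"
    then obtain t where "t \<in> gromov_sequences M d" "asymptotic M d s t" "u = \<psi> g \<circ> t"
      by (auto simp: boundary_map_def boundary_class_def)
    then show "u \<in> boundary_class (\<psi> g \<circ> s)"
      using act_gromov_sequence[OF g] act_asymptotic[OF g _ rs]
      by (simp add: boundary_class_def gromov_sequences_def)
  qed
  show "boundary_class (\<psi> g \<circ> s) \<subseteq> boundary_map (\<psi> g) (boundary_class s)"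
  proof
    fix u assume "u \<in> boundary_class (\<psi> g \<circ> s)"
    then have u: "u \<in> gromov_sequences M d" "asymptotic M d (\<psi> g \<circ> s) u"
      by (auto simp: boundary_class_def)
    have ru: "range u \<subseteq> M" using u by (simp add: gromov_sequences_def)
    have "\<psi> (inv g) \<circ> (\<psi> g \<circ> s) = s" "\<psi> g \<circ> (\<psi> (inv g) \<circ> u) = u"
      using rs ru g by (auto simp: fun_eq_iff image_subset_iff)
    moreover have "asymptotic M d (\<psi> (inv g) \<circ> (\<psi> g \<circ> s)) (\<psi> (inv g) \<circ> u)"
      using act_asymptotic[OF _ u(2) act_range[OF g rs] ru] g by blast
    moreover have "\<psi> (inv g) \<circ> u \<in> gromov_sequences M d"
      using act_gromov_sequence u g by blast
    ultimately show "u \<in> boundary_map (\<psi> g) (boundary_class s)"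
      unfolding boundary_map_def boundary_class_def
      by (intro image_eqI[of _ _ "\<psi> (inv g) \<circ> u"]) auto
  qed
qed

lemma boundary_map_in:
  assumes "g \<in> carrier G" "\<xi> \<in> gromov_boundary M d"
  shows "boundary_map (\<psi> g) \<xi> \<in> gromov_boundary M d"
  using assms boundary_representative boundary_map_class boundary_class_in act_gromov_sequence
  by metis

text \<open>
  Fixing a boundary point is tested on one representing sequence.
\<close>

lemma boundary_map_fixes_iff:
  assumes g: "g \<in> carrier G" and s: "s \<in> gromov_sequences M d"
  shows "boundary_map (\<psi> g) (boundary_class s) = boundary_class s
    \<longleftrightarrow> asymptotic M d (\<psi> g \<circ> s) s"
  using boundary_map_class[OF assms] boundary_class_eq_iff act_gromov_sequence assms by simp

lemma boundary_map_mult: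
  assumes g: "g \<in> carrier G" and h: "h \<in> carrier G" and \<xi>: "\<xi> \<in> gromov_boundary M d"
  shows "boundary_map (\<psi> (g \<otimes> h)) \<xi> = boundary_map (\<psi> g) (boundary_map (\<psi> h) \<xi>)"
proof -
  obtain s where s: "s \<in> gromov_sequences M d" "\<xi> = boundary_class s"
    using \<xi> by (rule boundary_representative)
  have "\<psi> (g \<otimes> h) \<circ> s = \<psi> g \<circ> (\<psi> h \<circ> s)"
    using s composition_rule g h by (auto simp: fun_eq_iff gromov_sequences_def image_subset_iff)
  then show ?thesis
    using s g h by (simp add: boundary_map_class act_gromov_sequence)
qed

lemma boundary_map_inj:
  assumes g: "g \<in> carrier G"
  shows "inj_on (boundary_map (\<psi> g)) (gromov_boundary M d)"
proof (rule inj_on_inverseI)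
  fix \<xi> assume \<xi>: "\<xi> \<in> gromov_boundary M d"
  obtain s where s: "s \<in> gromov_sequences M d" "\<xi> = boundary_class s"
    using \<xi> by (rule boundary_representative)
  have "\<psi> (inv g) \<circ> (\<psi> g \<circ> s) = s"
    using s g by (auto simp: fun_eq_iff gromov_sequences_def image_subset_iff)
  then show "boundary_map (\<psi> (inv g)) (boundary_map (\<psi> g) \<xi>) = \<xi>"
    using s g by (simp add: boundary_map_class act_gromov_sequence)
qed

lemma boundary_class_in_limit_set:
  assumes "s \<in> gromov_sequences M d" "p \<in> M" "\<And>i. \<exists>g\<in>carrier G. s i = \<psi> g p"
  shows "boundary_class s \<in> limit_set G M d \<psi>"
proof -
  have "range s \<subseteq> orbit G \<psi> p" using assms(3) by (auto simp: orbit_def)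
  then show ?thesis using boundary_class_in[OF assms(1)] assms(2) by (auto simp: limit_set_def)
qed

section \<open>Bounded orbits and loxodromic elements\<close>

lemma bounded_orbitsI:
  assumes p: "p \<in> M" and R: "\<And>g. g \<in> carrier G \<Longrightarrow> d p (\<psi> g p) \<le> R"
  shows "bounded_orbits G M d \<psi>"
  unfolding bounded_orbits_def
proof (intro ballI exI)
  fix x g assume x: "x \<in> M" and g: "g \<in> carrier G"
  have "d x (\<psi> g x) \<le> d x p + d p (\<psi> g p) + d (\<psi> g p) (\<psi> g x)"
    using triangle[of x p "\<psi> g x"] triangle[of p "\<psi> g p" "\<psi> g x"] x p g by auto
  then show "d x (\<psi> g x) \<le> 2 * d x p + R"
    using R[OF g] isometry[OF g p x] commute[of p x] by linarith
qed

lemma bounded_limit_set_empty: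
  assumes "bounded_orbits G M d \<psi>"
  shows "limit_set G M d \<psi> = {}"
proof (rule ccontr)
  assume "limit_set G M d \<psi> \<noteq> {}"
  then obtain \<xi> x s where \<xi>: "\<xi> \<in> gromov_boundary M d" "s \<in> \<xi>" and x: "x \<in> M"
    and s: "range s \<subseteq> orbit G \<psi> x" by (auto simp: limit_set_def)
  obtain R where R: "\<forall>g\<in>carrier G. d x (\<psi> g x) \<le> R" using assms x by (auto simp: bounded_orbits_def)
  have "d x (s i) \<le> R" for i
  proof -
    have "s i \<in> orbit G \<psi> x" using s by blast
    then obtain g where "g \<in> carrier G" "s i = \<psi> g x" unfolding orbit_def by blast
    then show ?thesis using R by simp
  qed
  then show False using bounded_not_gromov_sequence[OF x boundary_class_of_mem(1)[OF \<xi>]] by blast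
qed

lemma four_point_dist:
  assumes "x \<in> M" "y \<in> M" "z \<in> M" "w \<in> M"
  shows "d x z + d y w \<le> max (d x y + d z w) (d x w + d y z) + 2 * \<delta>"
  using four_point[OF assms(4,1,2,3)] two_gp[of w x y] two_gp[of w y z] two_gp[of w x z]
  by linarith

text \<open>
  A displacement criterion for loxodromic elements, relative to a base point: the square moves the
  base point further than the element itself does, by more than the error of hyperbolicity.
\<close>

abbreviation loxodromic_at where
  "loxodromic_at p g \<equiv> d p (\<psi> g p) + 2 * \<delta> + 1 \<le> d p (\<psi> (g \<otimes> g) p)"

lemma dist_powers:
  fixes i j :: nat
  assumes "g \<in> carrier G" "p \<in> M" "i \<le> j"
  shows "d (\<psi> (g [^] i) p) (\<psi> (g [^] j) p) = d p (\<psi> (g [^] (j - i)) p)"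
proof -
  have "\<psi> (g [^] j) p = \<psi> (g [^] i) (\<psi> (g [^] (j - i)) p)"
    using composition_rule[of p "g [^] i" "g [^] (j - i)"] grp.nat_pow_mult[of g i "j - i"] assms
    by simp
  then show ?thesis using isometry assms by simp
qed

text \<open>
  Apply the four-point inequality to \<open>p\<close>, \<open>g p\<close>, \<open>g\<^sup>2 p\<close> and \<open>g\<^sup>n p\<close>. With
  \<open>l n\<close> the displacement of \<open>p\<close> under \<open>g\<^sup>n\<close> it gives
  \<open>l 2 + l (n - 1) \<le> max (l 1 + l (n - 2)) (l n + l 1) + 2 * \<delta>\<close>, and as
  \<open>l 2\<close> exceeds \<open>l 1\<close> by \<open>2 * \<delta> + 1\<close>, growth by one at one step forces growth by one at the next.
\<close>

lemma loxodromic_growth: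
  assumes g: "g \<in> carrier G" and p: "p \<in> M" and lox: "loxodromic_at p g"
  shows "d p (\<psi> (g [^] (n::nat)) p) + 1 \<le> d p (\<psi> (g [^] Suc n) p)"
proof (induction n)
  define l where "l n = d p (\<psi> (g [^] (n::nat)) p)" for n
  define a where "a n = \<psi> (g [^] (n::nat)) p" for n
  have aM: "a n \<in> M" for n using g p by (simp add: a_def)
  have a0: "a 0 = p" using p by (simp add: a_def)
  have da: "d (a i) (a j) = l (j - i)" if "i \<le> j" for i j
    using dist_powers[OF g p that] by (simp add: a_def l_def)
  have l0: "l 0 = 0" using p by (simp add: l_def)
  have l12: "l 1 + 2 * \<delta> + 1 \<le> l 2"
    using lox g by (simp add: l_def numeral_2_eq_2)
  have "l 2 \<le> l 1 + l 1"
    using triangle[of "a 0" "a 1" "a 2"] aM da[of 0 1] da[of 1 2] da[of 0 2] by simp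
  then have "1 \<le> l 1" using l12 \<delta>_nonneg by linarith
  then show "d p (\<psi> (g [^] (0::nat)) p) + 1 \<le> d p (\<psi> (g [^] Suc 0) p)"
    using l0 by (simp add: l_def)
  fix n assume IH: "d p (\<psi> (g [^] n) p) + 1 \<le> d p (\<psi> (g [^] Suc n) p)"
  then have IH: "l n + 1 \<le> l (Suc n)" by (simp only: l_def)
  have "l 2 + l (Suc n) \<le> max (l 1 + l n) (l (Suc (Suc n)) + l 1) + 2 * \<delta>"
    using four_point_dist[of "a 0" "a 1" "a 2" "a (Suc (Suc n))"] aM
      da[of 0 1] da[of 1 2] da[of 0 2] da[of 1 "Suc (Suc n)"] da[of 0 "Suc (Suc n)"]
      da[of 2 "Suc (Suc n)"] by (simp add: numeral_2_eq_2)
  then have "l (Suc n) + 1 \<le> l (Suc (Suc n))"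
    using l12 IH unfolding max_def by (auto split: if_splits)
  then show "d p (\<psi> (g [^] Suc n) p) + 1 \<le> d p (\<psi> (g [^] Suc (Suc n)) p)"
    by (simp only: l_def)
qed

lemma loxodromic_growth_add:
  fixes n k :: nat
  assumes g: "g \<in> carrier G" and p: "p \<in> M" and lox: "loxodromic_at p g"
  shows "d p (\<psi> (g [^] n) p) + real k \<le> d p (\<psi> (g [^] (n + k)) p)"
proof (induction k)
  case (Suc k)
  then show ?case using loxodromic_growth[OF assms, of "n + k"] by simp
qed simp

lemma loxodromic_gromov_sequence:
  assumes g: "g \<in> carrier G" and p: "p \<in> M" and lox: "loxodromic_at p g"
  shows "(\<lambda>n. \<psi> (g [^] (n::nat)) p) \<in> gromov_sequences M d"
proof -
  define a where "a n = \<psi> (g [^] (n::nat)) p" for n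
  have r: "range a \<subseteq> M" using g p by (auto simp: a_def)
  have *: "real i \<le> gp p (a i) (a j)" if ij: "i \<le> j" for i j
  proof -
    have "d p (a (j - i)) + real i \<le> d p (a j)"
      using loxodromic_growth_add[OF assms, of "j - i" i] ij by (simp add: a_def)
    moreover have "real i \<le> d p (a i)"
      using loxodromic_growth_add[OF assms, of 0 i] p by (simp add: a_def)
    moreover have "d (a i) (a j) = d p (a (j - i))" using dist_powers[OF g p ij] by (simp add: a_def)
    ultimately show ?thesis using two_gp[of p "a i" "a j"] commute[of p]
      by simp
  qed
  have "asymptotic M d a a"
    unfolding asymptotic_iff[OF p r r]
  proof
    fix C :: real
    obtain N :: nat where N: "C \<le> N" using real_arch_simple by blast
    have "C \<le> gp p (a i) (a j)" if "i \<ge> N" "j \<ge> N" for i j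
    proof (cases "i \<le> j")
      case True
      then show ?thesis using *[OF True] that N by linarith
    next
      case False
      then show ?thesis using *[of j i] that N gp_commute[of p "a i"] by (simp add: le_trans)
    qed
    then show "\<exists>N. \<forall>i\<ge>N. \<forall>j\<ge>N. C \<le> gp p (a i) (a j)" by blast
  qed
  then show ?thesis using r unfolding gromov_sequences_def a_def by blast
qed

lemma dist_power_le:
  assumes h: "h \<in> carrier G" and y: "y \<in> M"
  shows "d y (\<psi> (h [^] (k::nat)) y) \<le> k * d y (\<psi> h y)"
proof (induction k)
  case (Suc k)
  have "d y (\<psi> (h [^] Suc k) y) \<le> d y (\<psi> (h [^] k) y) + d (\<psi> (h [^] k) y) (\<psi> (h [^] Suc k) y)"
    using triangle h y by simp
  also have "d (\<psi> (h [^] k) y) (\<psi> (h [^] Suc k) y) = d y (\<psi> h y)"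
    using dist_powers[OF h y, of k "Suc k"] h by simp
  finally show ?case using Suc by (simp add: algebra_simps)
qed (use y in simp)

text \<open>
  The displacement of \<open>p\<close> under \<open>g\<^sup>m\<close> is at least \<open>m\<close>, so the stable translation length of \<open>g\<close>
  is at least one, whatever point is used to compute it. For \<open>g\<^sup>n\<close> the displacement at \<open>y\<close> is
  at least the stable translation length, seen by passing to high powers of \<open>g\<^sup>n\<close>.
\<close>

lemma loxodromic_displacement:
  assumes g: "g \<in> carrier G" and p: "p \<in> M" and lox: "loxodromic_at p g" and y: "y \<in> M"
  shows "n \<le> d y (\<psi> (g [^] (n::nat)) y)"
proof (rule ccontr)
  assume neg: "\<not> n \<le> d y (\<psi> (g [^] n) y)"
  define D where "D = d y (\<psi> (g [^] n) y)"
  have le: "k * (n - D) \<le> 2 * d p y" for k :: nat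
  proof -
    have 1: "real (n * k) \<le> d p (\<psi> (g [^] (n * k)) p)"
      using loxodromic_growth_add[OF g p lox, of 0 "n * k"] p by simp
    have 2: "d y (\<psi> (g [^] (n * k)) y) \<le> k * D"
      using dist_power_le[of "g [^] n" y k] g y by (simp add: grp.nat_pow_pow D_def)
    let ?h = "g [^] (n * k)"
    have "d p (\<psi> ?h p) \<le> d p y + d y (\<psi> ?h y) + d (\<psi> ?h y) (\<psi> ?h p)"
      using triangle[of p y "\<psi> ?h p"] triangle[of y "\<psi> ?h y" "\<psi> ?h p"] g p y by auto
    then show ?thesis using 1 2 isometry[of ?h y p] g p y commute[of y p] by (simp add: algebra_simps)
  qed
  have "0 < n - D" using neg by (simp add: D_def)
  then obtain k :: nat where "2 * d p y < k * (n - D)" using reals_Archimedean3 by blast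
  then show False using le[of k] by linarith
qed

section \<open>Unbounded orbits and the limit set\<close>

text \<open>
  Without loxodromic elements all far orbit points lie in the same direction. For one element \<open>k\<close>,
  failure of the loxodromic criterion says that \<open>k p\<close> and \<open>k\<^sup>-\<^sup>1 p\<close> have a large product. If \<open>g p\<close> and
  \<open>h p\<close> had a small product, then so would \<open>g\<^sup>\<plusminus>\<^sup>1 p\<close> and \<open>h\<^sup>\<plusminus>\<^sup>1 p\<close>, and the product \<open>f = g h\<close>, whose
  orbit point follows \<open>g p\<close> while that of its inverse follows \<open>h\<^sup>-\<^sup>1 p\<close>, would be
  loxodromic (ping-pong).
\<close>

lemma orbit_product_lower_bound:
  assumes p: "p \<in> M" and nolox: "\<And>g. g \<in> carrier G \<Longrightarrow> \<not> loxodromic_at p g"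
    and g: "g \<in> carrier G" and h: "h \<in> carrier G"
  shows "min (d p (\<psi> g p)) (d p (\<psi> h p)) / 2 - 4 * \<delta> - 1 \<le> gp p (\<psi> g p) (\<psi> h p)"
proof (rule ccontr)
  \<comment> \<open>\<open>A\<close> and \<open>B\<close> are the two displacements and \<open>t\<close> the product supposed too small.\<close>
  define A B t where "A = d p (\<psi> g p)" and "B = d p (\<psi> h p)" and "t = gp p (\<psi> g p) (\<psi> h p)"
  assume "\<not> ?thesis"
  then have t: "2 * t < A - 8 * \<delta> - 2" "2 * t < B - 8 * \<delta> - 2" by (auto simp: A_def B_def t_def)
  have self: "d p (\<psi> k p) / 2 - \<delta> - 1/2 < gp p (\<psi> k p) (\<psi> (inv k) p)"
    if k: "k \<in> carrier G" for k
  proof -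
    have "d (\<psi> k p) (\<psi> (inv k) p) = d (\<psi> (k \<otimes> k) p) p"
      using isometry[of k "\<psi> k p" "\<psi> (inv k) p"] composition_rule[of p k k] k p by simp
    moreover have "d (\<psi> (inv k) p) p = d p (\<psi> k p)" using isometry_inv[OF k p p] by simp
    ultimately show ?thesis
      using nolox[OF k] commute[of p "\<psi> (inv k) p"] commute[of p "\<psi> k p"]
        commute[of p "\<psi> (k \<otimes> k) p"] two_gp[of p "\<psi> k p" "\<psi> (inv k) p"] by linarith
  qed
  have pts: "\<psi> g p \<in> M" "\<psi> h p \<in> M" "\<psi> (inv g) p \<in> M" "\<psi> (inv h) p \<in> M" using g h p by auto
  define u w where "u = gp p (\<psi> (inv g) p) (\<psi> h p)" and "w = gp p (\<psi> g p) (\<psi> (inv h) p)"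
  have u: "u \<le> t + \<delta>"
    using four_point[OF p pts(1,3,2)] self[OF g] t \<delta>_nonneg unfolding A_def u_def t_def by linarith
  have w: "w \<le> t + \<delta>"
    using four_point[OF p pts(1,4,2)] self[OF h] gp_commute[of p "\<psi> (inv h) p" "\<psi> h p"] t \<delta>_nonneg
    unfolding B_def w_def t_def by linarith
  \<comment> \<open>The displacement of \<open>f\<close> is nearly \<open>A + B - 2 * t\<close>, while the product of \<open>f p\<close> and
    \<open>inv f p\<close> is about \<open>t\<close>; as \<open>4 * t < A + B\<close>, it falls below half of the displacement.\<close>
  define f where "f = g \<otimes> h"
  have f: "f \<in> carrier G" using g h by (simp add: f_def)
  have fp: "\<psi> f p = \<psi> g (\<psi> h p)" "\<psi> (inv f) p = \<psi> (inv h) (\<psi> (inv g) p)"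
    using composition_rule p g h by (simp_all add: f_def grp.inv_mult_group)
  have lf: "d p (\<psi> f p) = A + B - 2 * u"
    using isometry_inv[OF g p pts(2)] isometry_inv[OF g p p] two_gp[of p "\<psi> (inv g) p" "\<psi> h p"]
      commute[of p "\<psi> h p"] by (simp add: A_def B_def u_def fp)
  have linv: "d p (\<psi> (inv f) p) = d p (\<psi> f p)"
    using isometry_inv[OF f p p] commute by simp
  have gf: "gp p (\<psi> g p) (\<psi> f p) = A - u"
    unfolding gromov_product_def fp(1) isometry[OF g p pts(2)] commute[of _ p]
    using lf fp(1) by (simp add: A_def B_def)
  have "d (\<psi> (inv f) p) (\<psi> (inv h) p) = A"
    unfolding fp using isometry[of "inv h" "\<psi> (inv g) p" p] h pts p isometry_inv[OF g p p]
    by (simp add: A_def)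
  moreover have "d p (\<psi> (inv h) p) = B" using isometry_inv[OF h p p] commute by (simp add: B_def)
  ultimately have fh: "gp p (\<psi> (inv f) p) (\<psi> (inv h) p) = B - u"
    unfolding gromov_product_def commute[of _ p] using lf linv by simp
  have "\<psi> f p \<in> M" "\<psi> (inv f) p \<in> M" using f p by auto
  note four_point2[OF p pts(1) this pts(4)]
  then have "A - u - 2 * \<delta> \<le> w \<or> gp p (\<psi> f p) (\<psi> (inv f) p) - 2 * \<delta> \<le> w \<or> B - u - 2 * \<delta> \<le> w"
    unfolding gf fh w_def by linarith
  then show False
    using self[OF f] lf u w t \<delta>_nonneg by (elim disjE) linarith+
qed

lemma unbounded_sequence:
  assumes p: "p \<in> M" and "\<not> bounded_orbits G M d \<psi>"
  obtains k where "\<And>n::nat. k n \<in> carrier G" "\<And>n. n \<le> d p (\<psi> (k n) p)"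
proof -
  have "\<exists>g\<in>carrier G. n \<le> d p (\<psi> g p)" for n :: nat
    using assms bounded_orbitsI[OF p, of n] by (meson linear)
  then show thesis using that by metis
qed

text \<open>
  The shift \<open>c\<close> leaves room for comparing a sequence with its translate by a group element, whose
  distances to \<open>p\<close> change by a bounded amount.
\<close>

lemma orbit_sequences_asymptotic:
  assumes p: "p \<in> M" and nolox: "\<And>g. g \<in> carrier G \<Longrightarrow> \<not> loxodromic_at p g"
    and k: "\<And>n::nat. k n \<in> carrier G" "\<And>n. real n - c \<le> d p (\<psi> (k n) p)"
    and l: "\<And>n::nat. l n \<in> carrier G" "\<And>n. real n - c \<le> d p (\<psi> (l n) p)"
  shows "asymptotic M d (\<lambda>n. \<psi> (k n) p) (\<lambda>n. \<psi> (l n) p)"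
proof -
  have r: "range (\<lambda>n. \<psi> (k n) p) \<subseteq> M" "range (\<lambda>n. \<psi> (l n) p) \<subseteq> M" using p k l by auto
  show ?thesis
    unfolding asymptotic_iff[OF p r]
  proof
    fix C
    obtain N :: nat where N: "2 * (C + 4 * \<delta> + 1) + c \<le> N" using real_arch_simple by blast
    have "C \<le> gp p (\<psi> (k i) p) (\<psi> (l j) p)" if "i \<ge> N" "j \<ge> N" for i j
    proof -
      have "real N \<le> i" "real N \<le> j" using that by auto
      then show ?thesis
        using orbit_product_lower_bound[OF p nolox k(1) l(1), of i j] N k(2)[of i] l(2)[of j]
        unfolding min_def by (auto split: if_splits)
    qed
    then show "\<exists>N. \<forall>i\<ge>N. \<forall>j\<ge>N. C \<le> gp p (\<psi> (k i) p) (\<psi> (l j) p)" by blast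
  qed
qed

text \<open>
  Without loxodromic elements any two orbit sequences escaping to infinity are asymptotic. They
  define one boundary point, and translating such a sequence gives another one, so that point is fixed.
\<close>

lemma unbounded_no_loxodromic:
  assumes p: "p \<in> M" and nolox: "\<And>g. g \<in> carrier G \<Longrightarrow> \<not> loxodromic_at p g"
    and unb: "\<not> bounded_orbits G M d \<psi>"
  obtains \<xi> where "\<xi> \<in> limit_set G M d \<psi>" "\<And>g. g \<in> carrier G \<Longrightarrow> boundary_map (\<psi> g) \<xi> = \<xi>"
proof -
  obtain k where k: "\<And>n::nat. k n \<in> carrier G" "\<And>n. n \<le> d p (\<psi> (k n) p)"
    using unbounded_sequence[OF p unb] by blast
  define s where "s = (\<lambda>n. \<psi> (k n) p)"
  have "asymptotic M d s s"
    unfolding s_def using orbit_sequences_asymptotic[OF p nolox k(1) _ k(1), of 0] k by simp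
  then have s: "s \<in> gromov_sequences M d" using k p by (auto simp: gromov_sequences_def s_def)
  have fixed: "boundary_map (\<psi> g) (boundary_class s) = boundary_class s" if g: "g \<in> carrier G" for g
  proof -
    define c where "c = d p (\<psi> g p)"
    have "real n - c \<le> d p (\<psi> (g \<otimes> k n) p)" for n
    proof -
      have "d (\<psi> g p) (\<psi> (g \<otimes> k n) p) = d p (\<psi> (k n) p)"
        using isometry[OF g p, of "\<psi> (k n) p"] composition_rule[OF p g k(1)] k p by simp
      moreover have "d (\<psi> g p) (\<psi> (g \<otimes> k n) p) \<le> d (\<psi> g p) p + d p (\<psi> (g \<otimes> k n) p)"
        using triangle g k p by simp
      ultimately show ?thesis using k(2)[of n] commute[of p] by (simp add: c_def)
    qed
    moreover have "real n - c \<le> d p (\<psi> (k n) p)" for n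
      using k(2)[of n] nonneg[of p "\<psi> g p"] unfolding c_def by linarith
    ultimately have "asymptotic M d (\<lambda>n. \<psi> (g \<otimes> k n) p) s"
      unfolding s_def using orbit_sequences_asymptotic[OF p nolox, of "\<lambda>n. g \<otimes> k n" c k] g k by simp
    moreover have "(\<lambda>n. \<psi> (g \<otimes> k n) p) = \<psi> g \<circ> s"
      using composition_rule[OF p g k(1)] by (auto simp: s_def)
    ultimately show ?thesis using boundary_map_fixes_iff[OF g s] by simp
  qed
  have "boundary_class s \<in> limit_set G M d \<psi>"
    by (rule boundary_class_in_limit_set[OF s p]) (auto simp: s_def k)
  then show thesis using fixed that by blast
qed

text \<open>
  The space need not be proper, so compactness of the boundary is not at hand. Either the powers of
  a loxodromic element or, in the absence of such elements, any escaping orbit sequence converges.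
\<close>

lemma unbounded_limit_set_nonempty:
  assumes "\<not> bounded_orbits G M d \<psi>"
  shows "limit_set G M d \<psi> \<noteq> {}"
proof -
  obtain p where p: "p \<in> M" using assms by (auto simp: bounded_orbits_def)
  show ?thesis
  proof (cases "\<exists>g\<in>carrier G. loxodromic_at p g")
    case True
    then obtain g where g: "g \<in> carrier G" and lox: "loxodromic_at p g" by blast
    note s = loxodromic_gromov_sequence[OF g p lox]
    have "boundary_class (\<lambda>n. \<psi> (g [^] (n::nat)) p) \<in> limit_set G M d \<psi>"
      by (rule boundary_class_in_limit_set[OF s p]) (use g in auto)
    then show ?thesis by blast
  next
    case False
    then show ?thesis using unbounded_no_loxodromic[OF p _ assms] by blast
  qed
qed

section \<open>Groups fixing three boundary points\<close>

text \<open>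
  The product of representatives of \<open>\<xi>\<close> and \<open>\<eta>\<close> measures the distance to a geodesic from \<open>\<xi>\<close> to
  \<open>\<eta>\<close>. A group fixing both ends moves this geodesic a bounded amount, so the bound is uniform along
  an orbit; only the index from which it holds depends on \<open>g\<close>.
\<close>

lemma fixed_pair_product_bound:
  assumes p: "p \<in> M" and \<xi>: "\<xi> \<in> gromov_boundary M d" and \<eta>: "\<eta> \<in> gromov_boundary M d"
    and ne: "\<xi> \<noteq> \<eta>" and a: "a \<in> \<xi>" and b: "b \<in> \<eta>"
    and fixed: "\<And>g. g \<in> carrier G \<Longrightarrow> boundary_map (\<psi> g) \<xi> = \<xi>"
      "\<And>g. g \<in> carrier G \<Longrightarrow> boundary_map (\<psi> g) \<eta> = \<eta>"
  obtains C where
    "\<And>g. g \<in> carrier G \<Longrightarrow> \<exists>N. \<forall>i\<ge>N. \<forall>j\<ge>N. gp (\<psi> g p) (a i) (b j) \<le> C"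
proof -
  note a' = boundary_class_of_mem[OF \<xi> a] and b' = boundary_class_of_mem[OF \<eta> b]
  have r: "range a \<subseteq> M" "range b \<subseteq> M" using a'(1) b'(1) by (simp_all add: gromov_sequences_def)
  have "\<not> asymptotic M d a b" using boundary_class_eq_iff[OF a'(1) b'(1)] a' b' ne by simp
  then obtain C N where CN: "\<And>i j. \<lbrakk>i \<ge> N; j \<ge> N\<rbrakk> \<Longrightarrow> gp p (a i) (b j) \<le> C"
    by (rule not_asymptotic_bounded[OF p a'(1) b'(1)]) blast
  have "\<exists>N. \<forall>i\<ge>N. \<forall>j\<ge>N. gp (\<psi> g p) (a i) (b j) \<le> C + 2 * \<delta>" if g: "g \<in> carrier G" for g
  proof -
    define h where "h = inv g"
    have h: "h \<in> carrier G" using g by (simp add: h_def)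
    have "asymptotic M d (\<psi> h \<circ> a) a" "asymptotic M d (\<psi> h \<circ> b) b"
      using boundary_map_fixes_iff[OF h a'(1)] boundary_map_fixes_iff[OF h b'(1)]
        fixed[OF h] a' b' by auto
    then obtain N1 N2 where
      N1: "\<forall>i\<ge>N1. \<forall>j\<ge>N1. C + 2 * \<delta> + 1 \<le> gp p ((\<psi> h \<circ> a) i) (a j)" and
      N2: "\<forall>i\<ge>N2. \<forall>j\<ge>N2. C + 2 * \<delta> + 1 \<le> gp p ((\<psi> h \<circ> b) i) (b j)"
      unfolding asymptotic_iff[OF p act_range[OF h r(1)] r(1)]
        asymptotic_iff[OF p act_range[OF h r(2)] r(2)] by meson
    define K where "K = max N (max N1 N2)"
    have "gp (\<psi> g p) (a i) (b j) \<le> C + 2 * \<delta>" if "i \<ge> K" "j \<ge> K" for i j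
    proof -
      have M: "a i \<in> M" "b j \<in> M" "a K \<in> M" "b K \<in> M" using r by auto
      have "gp (\<psi> g p) (a i) (b j) = gp p (\<psi> h (a i)) (\<psi> h (b j))"
        using isometry_gp[of h "\<psi> g p" "a i" "b j"] M g h p by (simp add: h_def)
      moreover have "C + 2 * \<delta> + 1 \<le> gp p (a K) (\<psi> h (a i))"
        "C + 2 * \<delta> + 1 \<le> gp p (\<psi> h (b j)) (b K)"
        using N1[rule_format, of i K] N2[rule_format, of j K] that gp_commute[of p "a K"]
        by (simp_all add: K_def)
      moreover have "gp p (a K) (b K) \<le> C" using CN[of K K] by (simp add: K_def)
      ultimately show ?thesis
        using four_point2[OF p M(3) act_closed[OF h M(1)] act_closed[OF h M(2)] M(4)] by linarith
    qed
    then show ?thesis by blast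
  qed
  then show thesis using that by blast
qed

text \<open>
  The group almost preserves the quasi-centre of the ideal triangle with the three fixed
  points as vertices, and this quasi-centre is bounded.
\<close>

lemma three_fixed_points_bounded:
  assumes bd: "\<xi> \<in> gromov_boundary M d" "\<eta> \<in> gromov_boundary M d" "\<zeta> \<in> gromov_boundary M d"
    and ne: "\<xi> \<noteq> \<eta>" "\<eta> \<noteq> \<zeta>" "\<xi> \<noteq> \<zeta>"
    and fixed: "\<And>g. g \<in> carrier G \<Longrightarrow> boundary_map (\<psi> g) \<xi> = \<xi>"
      "\<And>g. g \<in> carrier G \<Longrightarrow> boundary_map (\<psi> g) \<eta> = \<eta>"
      "\<And>g. g \<in> carrier G \<Longrightarrow> boundary_map (\<psi> g) \<zeta> = \<zeta>"
  shows "bounded_orbits G M d \<psi>"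
proof -
  obtain a b c where abc: "a \<in> \<xi>" "b \<in> \<eta>" "c \<in> \<zeta>"
    using bd boundary_representative boundary_class_in(2) by metis
  have r: "range a \<subseteq> M" "range b \<subseteq> M" "range c \<subseteq> M"
    using boundary_class_of_mem(1) bd abc by (auto simp: gromov_sequences_def)
  then obtain p where p: "p \<in> M" by blast
  obtain C1 where C1: "\<And>g. g \<in> carrier G \<Longrightarrow> \<exists>N. \<forall>i\<ge>N. \<forall>j\<ge>N. gp (\<psi> g p) (a i) (b j) \<le> C1"
    using fixed_pair_product_bound[OF p bd(1,2) ne(1) abc(1,2) fixed(1,2)] by blast
  obtain C2 where C2: "\<And>g. g \<in> carrier G \<Longrightarrow> \<exists>N. \<forall>i\<ge>N. \<forall>j\<ge>N. gp (\<psi> g p) (b i) (c j) \<le> C2"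
    using fixed_pair_product_bound[OF p bd(2,3) ne(2) abc(2,3) fixed(2,3)] by blast
  obtain C3 where C3: "\<And>g. g \<in> carrier G \<Longrightarrow> \<exists>N. \<forall>i\<ge>N. \<forall>j\<ge>N. gp (\<psi> g p) (a i) (c j) \<le> C3"
    using fixed_pair_product_bound[OF p bd(1,3) ne(3) abc(1,3) fixed(1,3)] by blast
  define C where "C = max C1 (max C2 C3)"
  have far: "\<exists>N. \<forall>n\<ge>N. gp (\<psi> g p) (a n) (b n) \<le> C \<and> gp (\<psi> g p) (b n) (c n) \<le> C \<and>
      gp (\<psi> g p) (a n) (c n) \<le> C" if g: "g \<in> carrier G" for g
  proof -
    obtain N1 N2 N3 where "\<forall>i\<ge>N1. \<forall>j\<ge>N1. gp (\<psi> g p) (a i) (b j) \<le> C1"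
      "\<forall>i\<ge>N2. \<forall>j\<ge>N2. gp (\<psi> g p) (b i) (c j) \<le> C2"
      "\<forall>i\<ge>N3. \<forall>j\<ge>N3. gp (\<psi> g p) (a i) (c j) \<le> C3"
      using C1[OF g] C2[OF g] C3[OF g] by blast
    then show ?thesis unfolding C_def
      by (intro exI[of _ "max N1 (max N2 N3)"]) (auto simp: le_max_iff_disj)
  qed
  show ?thesis
  proof (rule bounded_orbitsI[OF p])
    fix g assume g: "g \<in> carrier G"
    obtain N where N: "\<forall>n\<ge>N. gp (\<psi> g p) (a n) (b n) \<le> C \<and> gp (\<psi> g p) (b n) (c n) \<le> C \<and>
      gp (\<psi> g p) (a n) (c n) \<le> C" using far[OF g] by blast
    obtain N' where N': "\<forall>n\<ge>N'. gp (\<psi> \<one> p) (a n) (b n) \<le> C \<and> gp (\<psi> \<one> p) (b n) (c n) \<le> C \<and>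
      gp (\<psi> \<one> p) (a n) (c n) \<le> C" using far[OF grp.one_closed] by blast
    let ?n = "max N N'"
    have "a ?n \<in> M" "b ?n \<in> M" "c ?n \<in> M" using r by auto
    then show "d p (\<psi> g p) \<le> 2 * (C + \<delta>)"
      using quasi_centres_close[of p "\<psi> g p" "a ?n" "b ?n" "c ?n" C] N[rule_format, of ?n]
        N'[rule_format, of ?n] p g by simp
  qed
qed

section \<open>Limit sets of subgroups\<close>

text \<open>
  A subgroup \<open>H\<close> is handled as the group with carrier \<open>H\<close>, so that everything proved for the acting
  group applies to it (lemma \<open>subgroup_action\<close>).
\<close>

abbreviation limit where "limit H \<equiv> limit_set (G\<lparr>carrier := H\<rparr>) M d \<psi>"
abbreviation bounded_subgroup where "bounded_subgroup H \<equiv> bounded_orbits (G\<lparr>carrier := H\<rparr>) M d \<psi>"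

lemma subgroup_action:
  assumes "subgroup H G"
  shows "hyperbolic_action M d \<delta> (G\<lparr>carrier := H\<rparr>) \<psi>"
proof -
  have "group_hom (G\<lparr>carrier := H\<rparr>) (BijGroup M) \<psi>"
    using group_hom grp.subgroup_imp_group[OF assms] subgroup.subset[OF assms]
    unfolding group_hom_def group_hom_axioms_def hom_def by (auto simp: Pi_iff subset_iff)
  then have "group_action (G\<lparr>carrier := H\<rparr>) M \<psi>" by (rule group_action.intro)
  moreover have "hyperbolic_action_axioms M d (G\<lparr>carrier := H\<rparr>) \<psi>"
    using isometry subgroup.subset[OF assms] by (auto simp: hyperbolic_action_axioms_def)
  ultimately show ?thesis
    using hyperbolic_metric_axioms by (simp add: hyperbolic_action_def)
qed

lemma limit_iff:
  "\<xi> \<in> limit H \<longleftrightarrow> \<xi> \<in> gromov_boundary M d \<and> (\<exists>x\<in>M. \<exists>s\<in>\<xi>. \<forall>i. \<exists>h\<in>H. s i = \<psi> h x)"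
proof -
  have "range s \<subseteq> orbit (G\<lparr>carrier := H\<rparr>) \<psi> x \<longleftrightarrow> (\<forall>i. \<exists>h\<in>H. s i = \<psi> h x)" for s :: "nat \<Rightarrow> 'y" and x
    unfolding orbit_def image_subset_iff by auto
  then show ?thesis by (simp add: limit_set_def)
qed

lemma limit_subset_boundary: "limit H \<subseteq> gromov_boundary M d"
  by (auto simp: limit_set_def)

lemma limit_mono: "H \<subseteq> K \<Longrightarrow> limit H \<subseteq> limit K"
  unfolding limit_iff subset_iff by meson

text \<open>
  If \<open>k\<close> commutes with \<open>h\<close>, then \<open>k\<close> moves \<open>h x\<close> as far as it moves \<open>x\<close>. So \<open>k\<close> moves all
  points of the orbit of \<open>x\<close> by the same distance, which is invisible on the boundary.
\<close>

lemma commuting_fixes_limit: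
  assumes H: "H \<subseteq> carrier G" and k: "k \<in> carrier G"
    and comm: "\<And>h. h \<in> H \<Longrightarrow> h \<otimes> k = k \<otimes> h" and \<xi>: "\<xi> \<in> limit H"
  shows "boundary_map (\<psi> k) \<xi> = \<xi>"
proof -
  obtain x s where bd: "\<xi> \<in> gromov_boundary M d" and x: "x \<in> M" and s: "s \<in> \<xi>"
    and r: "\<forall>i. \<exists>h\<in>H. s i = \<psi> h x"
    using \<xi> unfolding limit_iff by blast
  note s' = boundary_class_of_mem[OF bd s]
  have rM: "range s \<subseteq> M" and ss: "asymptotic M d s s" using s'(1) by (auto simp: gromov_sequences_def)
  have "d (s i) ((\<psi> k \<circ> s) i) \<le> d x (\<psi> k x)" for i
  proof -
    obtain h where h: "h \<in> H" "s i = \<psi> h x" using r by blast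
    then have hG: "h \<in> carrier G" using H by blast
    have "\<psi> k (\<psi> h x) = \<psi> h (\<psi> k x)"
      using composition_rule[OF x k hG] composition_rule[OF x hG k] comm[OF h(1)] by simp
    then show ?thesis using isometry[OF hG x, of "\<psi> k x"] h x k by simp
  qed
  then have "asymptotic M d s (\<psi> k \<circ> s)"
    by (rule asymptotic_bounded_distance[OF ss rM act_range[OF k rM]])
  then have "asymptotic M d (\<psi> k \<circ> s) s"
    using asymptotic_sym rM act_range[OF k rM] by blast
  then show ?thesis using boundary_map_fixes_iff[OF k s'(1)] s'(2) by simp
qed

lemma limit_conjugate:
  assumes H: "H \<subseteq> carrier G" and g: "g \<in> carrier G"
  shows "boundary_map (\<psi> g) ` limit H \<subseteq> limit (conjugate_set G g H)"
proof (intro subsetI, elim imageE)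
  fix \<xi> \<eta> assume \<xi>: "\<xi> \<in> limit H" and \<eta>: "\<eta> = boundary_map (\<psi> g) \<xi>"
  obtain x s where bd: "\<xi> \<in> gromov_boundary M d" and x: "x \<in> M" and s: "s \<in> \<xi>"
    and r: "\<forall>i. \<exists>h\<in>H. s i = \<psi> h x"
    using \<xi> unfolding limit_iff by blast
  have "\<exists>h\<in>conjugate_set G g H. (\<psi> g \<circ> s) i = \<psi> h (\<psi> g x)" for i
  proof -
    obtain h where h: "h \<in> H" "s i = \<psi> h x" using r by blast
    have hG: "h \<in> carrier G" using h H by blast
    have "\<psi> (g \<otimes> h \<otimes> inv g) (\<psi> g x) = \<psi> g (\<psi> h x)"
      using composition_rule[of "\<psi> g x" "g \<otimes> h" "inv g"] composition_rule[of x g h] x g hG by simp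
    then show ?thesis
      using h unfolding conjugate_set_def by (intro bexI[of _ "g \<otimes> h \<otimes> inv g"]) auto
  qed
  moreover have "\<psi> g \<circ> s \<in> \<eta>" using s \<eta> by (simp add: boundary_map_def)
  ultimately show "\<eta> \<in> limit (conjugate_set G g H)"
    unfolding limit_iff using boundary_map_in[OF g bd] act_closed[OF g x] \<eta> by blast
qed

lemma bounded_conjugate:
  assumes H: "subgroup H G" and g: "g \<in> carrier G" and b: "bounded_subgroup H"
  shows "bounded_subgroup (conjugate_set G g H)"
  unfolding bounded_orbits_def
proof
  fix x assume x: "x \<in> M"
  obtain R where R: "\<forall>h\<in>H. d (\<psi> (inv g) x) (\<psi> h (\<psi> (inv g) x)) \<le> R"
    using b x g by (auto simp: bounded_orbits_def)
  have "d x (\<psi> (g \<otimes> h \<otimes> inv g) x) \<le> R" if h: "h \<in> H" for h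
  proof -
    have hG: "h \<in> carrier G" using h subgroup.subset[OF H] by blast
    have "\<psi> (g \<otimes> h \<otimes> inv g) x = \<psi> g (\<psi> h (\<psi> (inv g) x))"
      using composition_rule[of x "g \<otimes> h" "inv g"] composition_rule[of "\<psi> (inv g) x" g h] x g hG
      by simp
    then show ?thesis using isometry_inv[OF g x, of "\<psi> h (\<psi> (inv g) x)"] R h x g hG by simp
  qed
  then show "\<exists>R. \<forall>g'\<in>carrier (G\<lparr>carrier := conjugate_set G g H\<rparr>). d x (\<psi> g' x) \<le> R"
    by (auto simp: conjugate_set_def)
qed


section \<open>Groups that factor through commuting conjugate subgroups\<close>

text \<open>
  Only the displacement of each single element at a suitable point is bounded. That point may vary with
  the element, so the orbits of the group need not be bounded; the group could fix a boundary
  point and act by elliptic and parabolic isometries.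
\<close>

lemma bounded_displacement_not_general_type:
  assumes R: "\<And>g. g \<in> carrier G \<Longrightarrow> \<exists>y\<in>M. d y (\<psi> g y) \<le> R"
  shows "\<not> general_type G M d \<psi>"
proof
  assume gt: "general_type G M d \<psi>"
  then have ne: "limit_set G M d \<psi> \<noteq> {}" by (auto simp: general_type_def)
  then obtain p where p: "p \<in> M" by (auto simp: limit_set_def)
  have nolox: "\<not> loxodromic_at p g" if g: "g \<in> carrier G" for g
  proof
    assume lox: "loxodromic_at p g"
    obtain n :: nat where n: "R < n" using reals_Archimedean2 by blast
    obtain y where "y \<in> M" "d y (\<psi> (g [^] n) y) \<le> R" using R[of "g [^] n"] g by blast
    then show False using loxodromic_displacement[OF g p lox, of y n] n by linarith
  qed
  show False
  proof (cases "bounded_orbits G M d \<psi>")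
    case True
    then show False using bounded_limit_set_empty ne by blast
  next
    case False
    then obtain \<xi> where "\<xi> \<in> limit_set G M d \<psi>" "\<And>g. g \<in> carrier G \<Longrightarrow> boundary_map (\<psi> g) \<xi> = \<xi>"
      using unbounded_no_loxodromic[OF p nolox] by blast
    then show False using gt unfolding general_type_def limit_set_def by blast
  qed
qed

lemma commuting_unbounded_limit_finite:
  assumes H: "subgroup H G" and K: "subgroup K G"
    and comm: "\<And>h k. \<lbrakk>h \<in> H; k \<in> K\<rbrakk> \<Longrightarrow> h \<otimes> k = k \<otimes> h"
    and unb: "\<not> bounded_subgroup H"
  shows "finite (limit K)"
proof (rule ccontr)
  interpret H: hyperbolic_action M d \<delta> "G\<lparr>carrier := H\<rparr>" \<psi> by (rule subgroup_action[OF H])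
  assume "infinite (limit K)"
  then obtain T where T: "card T = 3" "T \<subseteq> limit K" using infinite_arbitrarily_large by metis
  obtain \<xi> \<eta> \<zeta> where T3: "T = {\<xi>, \<eta>, \<zeta>}" and ne: "\<xi> \<noteq> \<eta>" "\<eta> \<noteq> \<zeta>" "\<xi> \<noteq> \<zeta>"
    using T(1) unfolding card_3_iff by blast
  have in_limit: "\<xi> \<in> limit K" "\<eta> \<in> limit K" "\<zeta> \<in> limit K" using T(2) T3 by auto
  have bd: "\<xi> \<in> gromov_boundary M d" "\<eta> \<in> gromov_boundary M d" "\<zeta> \<in> gromov_boundary M d"
    using in_limit limit_subset_boundary[of K] by blast+
  have fixed: "boundary_map (\<psi> h) x = x" if "h \<in> carrier (G\<lparr>carrier := H\<rparr>)" "x \<in> limit K" for h x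
  proof -
    have h: "h \<in> H" "h \<in> carrier G" using that(1) subgroup.subset[OF H] by auto
    show ?thesis
      using commuting_fixes_limit[OF subgroup.subset[OF K] h(2) _ that(2)] comm[OF h(1)] by simp
  qed
  have "bounded_subgroup H"
    by (rule H.three_fixed_points_bounded[OF bd ne fixed fixed fixed]) (use in_limit in blast)+
  then show False using unb by blast
qed

text \<open>
  The family \<open>\<S>\<close> stands for the fixers of basic sets and \<open>\<P>\<close> for the pairs belonging to disjoint
  basic sets. Conjugacy of pairs serves the bounded case, where a factorization must be moved
  into one fixed pair; commutation and the chains of inclusions serve the unbounded case, where the
  limit sets of all members of \<open>\<S>\<close> are shown to coincide.
\<close>

theorem commuting_conjugates_not_general_type:
  assumes subgroups: "\<And>H. H \<in> \<S> \<Longrightarrow> subgroup H G"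
    and pairs: "\<P> \<subseteq> \<S> \<times> \<S>"
    and conj: "\<And>H H'. \<lbrakk>H \<in> \<S>; H' \<in> \<S>\<rbrakk> \<Longrightarrow> \<exists>g\<in>carrier G. H' = conjugate_set G g H"
    and conj_pairs: "\<And>H K H' K'. \<lbrakk>(H, K) \<in> \<P>; (H', K') \<in> \<P>\<rbrakk> \<Longrightarrow>
      \<exists>g\<in>carrier G. H' = conjugate_set G g H \<and> K' = conjugate_set G g K"
    and factor: "\<And>g. g \<in> carrier G \<Longrightarrow> \<exists>(H, K)\<in>\<P>. \<exists>a\<in>H. \<exists>b\<in>K. g = a \<otimes> b"
    and comm: "\<And>H. H \<in> \<S> \<Longrightarrow> \<exists>K\<in>\<S>. \<forall>h\<in>H. \<forall>k\<in>K. h \<otimes> k = k \<otimes> h"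
    and zigzag: "\<And>H H'. \<lbrakk>H \<in> \<S>; H' \<in> \<S>\<rbrakk> \<Longrightarrow>
      \<exists>U\<in>\<S>. \<exists>J\<in>\<S>. \<exists>U'\<in>\<S>. H \<subseteq> U \<and> J \<subseteq> U \<and> J \<subseteq> U' \<and> H' \<subseteq> U'"
  shows "\<not> general_type G M d \<psi>"
proof -
  have sub: "H \<subseteq> carrier G" if "H \<in> \<S>" for H using subgroups[OF that] by (rule subgroup.subset)
  obtain H0 K0 where HK: "(H0, K0) \<in> \<P>" using factor[OF grp.one_closed] by blast
  then have H0: "H0 \<in> \<S>" and K0: "K0 \<in> \<S>" using pairs by auto
  \<comment> \<open>For empty \<open>M\<close> the subgroup is trivially bounded but offers no base point; this degenerate case is
    absorbed by the second branch, where it contradicts the limit set being infinite.\<close>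
  show ?thesis
  proof (cases "bounded_subgroup H0 \<and> M \<noteq> {}")
    case True
    then obtain p where p: "p \<in> M" by blast
    have "bounded_subgroup K0" using conj[OF H0 K0] bounded_conjugate[OF subgroups[OF H0]] True by blast
    then obtain S where S: "\<forall>h\<in>K0. d p (\<psi> h p) \<le> S"
      using p by (auto simp: bounded_orbits_def)
    obtain R where R: "\<forall>h\<in>H0. d p (\<psi> h p) \<le> R"
      using True p by (auto simp: bounded_orbits_def)
    show ?thesis
    proof (rule bounded_displacement_not_general_type)
      fix g assume g: "g \<in> carrier G"
      obtain H K a' b' where HK': "(H, K) \<in> \<P>" and a': "a' \<in> H" and b': "b' \<in> K" and g': "g = a' \<otimes> b'"
        using factor[OF g] by blast
      obtain k where k: "k \<in> carrier G" and "H = conjugate_set G k H0" "K = conjugate_set G k K0"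
        using conj_pairs[OF HK HK'] by blast
      then obtain a b where a: "a \<in> H0" "a' = k \<otimes> a \<otimes> inv k" and b: "b \<in> K0" "b' = k \<otimes> b \<otimes> inv k"
        using a' b' by (auto simp: conjugate_set_def)
      have aG: "a \<in> carrier G" and bG: "b \<in> carrier G" using a b sub H0 K0 by auto
      have comp: "\<psi> (k \<otimes> c \<otimes> inv k) (\<psi> k q) = \<psi> k (\<psi> c q)" if "c \<in> carrier G" "q \<in> M" for c q
        using composition_rule[of "\<psi> k q" "k \<otimes> c" "inv k"] composition_rule[of q k c] k that by simp
      have "\<psi> g (\<psi> k p) = \<psi> k (\<psi> a (\<psi> b p))"
        using composition_rule[of "\<psi> k p" a' b'] comp[OF bG p] comp[OF aG, of "\<psi> b p"] p k aG bG
        by (simp add: g' a b)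
      then have "d (\<psi> k p) (\<psi> g (\<psi> k p)) = d p (\<psi> a (\<psi> b p))"
        using isometry k p aG bG by simp
      also have "\<dots> \<le> d p (\<psi> a p) + d (\<psi> a p) (\<psi> a (\<psi> b p))" using triangle p aG bG by simp
      also have "\<dots> \<le> R + S" using R S a b isometry[OF aG p, of "\<psi> b p"] p bG by (simp add: add_mono)
      finally show "\<exists>y\<in>M. d y (\<psi> g y) \<le> R + S" using p k by blast
    qed
  next
    case False
    show ?thesis
    proof
      assume gt: "general_type G M d \<psi>"
      then have "limit_set G M d \<psi> \<noteq> {}" by (auto simp: general_type_def)
      then have "M \<noteq> {}" by (auto simp: limit_set_def)
      then have unb0: "\<not> bounded_subgroup H0" using False by blast
      have unb: "\<not> bounded_subgroup H" if "H \<in> \<S>" for H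
        using conj[OF that H0] bounded_conjugate[OF subgroups[OF that]] unb0 by blast
      obtain K where K: "K \<in> \<S>" and "\<forall>h\<in>H0. \<forall>k\<in>K. h \<otimes> k = k \<otimes> h" using comm[OF H0] by blast
      then have finK: "finite (limit K)"
        using commuting_unbounded_limit_finite[OF subgroups[OF H0] subgroups[OF K]] unb0 by blast
      \<comment> \<open>Conjugation carries limit sets into each other injectively in both directions, so all limit sets
        are finite of the same size and an inclusion between two of them is an equality.\<close>
      have inj: "\<exists>f. inj_on f (limit H) \<and> f ` limit H \<subseteq> limit H'" if "H \<in> \<S>" "H' \<in> \<S>" for H H'
        using conj[OF that] limit_conjugate[OF sub[OF that(1)]]
          inj_on_subset[OF boundary_map_inj limit_subset_boundary] by metis
      have fin: "finite (limit H)" if "H \<in> \<S>" for H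
        using inj[OF that K] finK by (metis inj_on_finite)
      have card: "card (limit H) \<le> card (limit H')" if "H \<in> \<S>" "H' \<in> \<S>" for H H'
        using inj[OF that] fin[OF that(2)] card_inj_on_le by blast
      have eq_sub: "limit H = limit H'" if "H \<in> \<S>" "H' \<in> \<S>" "H \<subseteq> H'" for H H'
        using card_subset_eq[OF fin limit_mono] card that by (simp add: le_antisym)
      have eq: "limit H = limit H'" if "H \<in> \<S>" "H' \<in> \<S>" for H H'
        using zigzag[OF that] eq_sub that by metis
      interpret H0: hyperbolic_action M d \<delta> "G\<lparr>carrier := H0\<rparr>" \<psi>
        by (rule subgroup_action[OF subgroups[OF H0]])
      obtain \<xi> where \<xi>: "\<xi> \<in> limit H0"
        using H0.unbounded_limit_set_nonempty unb0 by blast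
      have bd: "\<xi> \<in> gromov_boundary M d" using \<xi> limit_subset_boundary by blast
      have fixed: "boundary_map (\<psi> h) \<xi> = \<xi>" if H: "H \<in> \<S>" and h: "h \<in> H" for H h
      proof -
        obtain K where K: "K \<in> \<S>" and c: "\<forall>h\<in>H. \<forall>k\<in>K. h \<otimes> k = k \<otimes> h" using comm[OF H] by blast
        show ?thesis
          using commuting_fixes_limit[OF sub[OF K], of h \<xi>] c h sub[OF H] \<xi> eq[OF H0 K] by auto
      qed
      have "boundary_map (\<psi> g) \<xi> = \<xi>" if g: "g \<in> carrier G" for g
      proof -
        obtain H K a b where "(H, K) \<in> \<P>" "a \<in> H" "b \<in> K" "g = a \<otimes> b" using factor[OF g] by blast
        moreover from this have "H \<in> \<S>" "K \<in> \<S>" using pairs by auto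
        ultimately show ?thesis
          using boundary_map_mult[of a b \<xi>] fixed bd sub by (metis subsetD)
      qed
      then show False using gt bd unfolding general_type_def by blast
    qed
  qed
qed

end

section \<open>Flexible actions on compact Hausdorff spaces\<close>

locale flexible_action = faithful_action G "topspace X" \<phi>
  for G :: "('g, 'm) monoid_scheme" (structure) and X :: "'x topology" and \<phi> :: "'g \<Rightarrow> 'x \<Rightarrow> 'x" +
  fixes \<I> :: "'x set set"
  assumes compact: "compact_space X"
    and Hausdorff: "Hausdorff_space X"
    and basis: "openin X = arbitrary union_of (\<lambda>U. U \<in> \<I>)"
    and nonempty: "\<And>I. I \<in> \<I> \<Longrightarrow> I \<noteq> {}"
    and nondense: "\<And>I. I \<in> \<I> \<Longrightarrow> X closure_of I \<noteq> topspace X"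
    and complements: "\<And>I. I \<in> \<I> \<Longrightarrow> \<exists>J\<in>\<I>. topspace X - I \<subseteq> J"
    and double_transitivity:
      "\<And>I J I' J'. [I, J] \<in> disjoint_tuples X \<I> 2 \<Longrightarrow> [I', J'] \<in> disjoint_tuples X \<I> 2 \<Longrightarrow>
         \<exists>g\<in>carrier G. \<phi> g ` I = I' \<and> \<phi> g ` J = J'"
    and weak_triple_transitivity:
      "\<And>g h. g \<in> carrier G \<Longrightarrow> h \<in> carrier G \<Longrightarrow>
         \<exists>M N P. [M, N, P] \<in> disjoint_tuples X \<I> 3 \<and>
           [\<phi> g ` M, \<phi> h ` N, P] \<in> disjoint_tuples X \<I> 3 \<and>
           (\<exists>k\<in>carrier G. \<phi> k ` M = \<phi> g ` M \<and> \<phi> k ` N = \<phi> h ` N \<and> \<phi> k ` P = P)"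
    and local_action:
      "\<And>I J K g h. [I, J, K] \<in> disjoint_tuples X \<I> 3 \<Longrightarrow> g \<in> carrier G \<Longrightarrow> h \<in> carrier G \<Longrightarrow>
         \<phi> g ` I = I \<Longrightarrow> \<phi> h ` J = J \<Longrightarrow>
         \<exists>b\<in>carrier G. (\<forall>x\<in>I. \<phi> b x = \<phi> g x) \<and> (\<forall>x\<in>J. \<phi> b x = \<phi> h x) \<and> (\<forall>x\<in>K. \<phi> b x = x)"

sublocale flexible_action \<subseteq> grp: group G
  using group_hom group_hom.axioms(1) by auto

context flexible_action
begin

abbreviation apart where "apart I J \<equiv> [I, J] \<in> disjoint_tuples X \<I> 2"

definition fixer :: "'x set \<Rightarrow> 'g set" where
  "fixer I = {g \<in> carrier G. \<forall>x\<in>I. \<phi> g x = x}"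

lemma apart_iff:
  "apart I J \<longleftrightarrow> I \<in> \<I> \<and> J \<in> \<I> \<and> disjnt (X closure_of I) (X closure_of J)
     \<and> X closure_of (I \<union> J) \<noteq> topspace X"
  by (auto simp: disjoint_tuples_def less_Suc_eq numeral_2_eq_2 disjnt_sym)

lemma apart_sym: "apart I J \<Longrightarrow> apart J I"
  by (auto simp: apart_iff disjnt_sym Un_commute)

lemma triple_apart:
  assumes "[M, N, P] \<in> disjoint_tuples X \<I> 3"
  shows "apart M N" "P \<in> \<I>" "disjnt (X closure_of M) (X closure_of P)"
    "disjnt (X closure_of N) (X closure_of P)"
proof -
  have *: "M \<in> \<I>" "N \<in> \<I>" "P \<in> \<I>" "X closure_of (M \<union> N \<union> P) \<noteq> topspace X"
    and dj: "\<And>i j. \<lbrakk>i < 3; j < 3; i \<noteq> j\<rbrakk> \<Longrightarrow>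
        disjnt (X closure_of ([M, N, P] ! i)) (X closure_of ([M, N, P] ! j))"
    using assms by (auto simp: disjoint_tuples_def Un_assoc)
  have "X closure_of (M \<union> N) \<noteq> topspace X"
    using * closure_of_mono[of "M \<union> N" "M \<union> N \<union> P" X] closure_of_subset_topspace[of X "M \<union> N \<union> P"]
    by blast
  then show "apart M N" "P \<in> \<I>" "disjnt (X closure_of M) (X closure_of P)"
    "disjnt (X closure_of N) (X closure_of P)"
    using * dj[of 0 1] dj[of 0 2] dj[of 1 2] unfolding apart_iff by (simp_all add: numeral_2_eq_2)
qed

lemma act_closed: "\<lbrakk>g \<in> carrier G; x \<in> topspace X\<rbrakk> \<Longrightarrow> \<phi> g x \<in> topspace X"
  using element_image by blast

lemma act_one: "x \<in> topspace X \<Longrightarrow> \<phi> \<one> x = x"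
  using id_eq_one by (metis restrict_apply')

lemma act_inv:
  assumes "g \<in> carrier G" "x \<in> topspace X"
  shows "\<phi> (inv g) (\<phi> g x) = x" "\<phi> g (\<phi> (inv g) x) = x"
  using composition_rule[of x "inv g" g] composition_rule[of x g "inv g"] assms by (auto simp: act_one)

lemma act_ext:
  assumes "g \<in> carrier G" "h \<in> carrier G" "\<And>x. x \<in> topspace X \<Longrightarrow> \<phi> g x = \<phi> h x"
  shows "g = h"
proof -
  have "\<phi> g = \<phi> h"
    using bij_prop0[OF assms(1)] bij_prop0[OF assms(2)] assms(3)
    by (auto simp: Bij_def intro: extensionalityI)
  then show ?thesis using faithful assms by (auto dest: inj_onD)
qed

lemma basis_open: "I \<in> \<I> \<Longrightarrow> openin X I"
  by (simp add: basis arbitrary_union_of_inc)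

lemma basis_topspace: "I \<in> \<I> \<Longrightarrow> I \<subseteq> topspace X"
  using basis_open openin_subset by blast

lemma basis_shrink:
  assumes "openin X U" "x \<in> U"
  obtains I where "I \<in> \<I>" "x \<in> I" "X closure_of I \<subseteq> U"
proof -
  have reg: "regular_space X" using compact Hausdorff by (rule compact_Hausdorff_imp_regular_space)
  have U: "closedin X (topspace X - U)" "x \<in> topspace X - (topspace X - U)"
    using assms openin_subset[OF assms(1)] by auto
  then obtain V where V: "openin X V" "x \<in> V" "disjnt (topspace X - U) (X closure_of V)"
    using reg[unfolded regular_space, rule_format, OF conjI[OF U]] by (elim exE conjE)
  obtain I where I: "I \<in> \<I>" "x \<in> I" "I \<subseteq> V"
  proof -
    obtain \<U> where "\<U> \<subseteq> \<I>" "\<Union>\<U> = V"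
      using V(1) unfolding basis union_of_def arbitrary_def by auto
    then show thesis using V(2) that by blast
  qed
  have "X closure_of I \<subseteq> X closure_of V" using I by (simp add: closure_of_mono)
  then have "X closure_of I \<subseteq> U"
    using V(3) closure_of_subset_topspace[of X I] by (auto simp: disjnt_iff)
  then show thesis using that I by blast
qed

lemma basis_subset_closure: "I \<in> \<I> \<Longrightarrow> I \<subseteq> X closure_of I"
  by (simp add: basis_topspace closure_of_subset)

lemma openin_remove_point: "openin X U \<Longrightarrow> openin X (U - {x})"
  using Hausdorff by (metis Diff_empty Diff_insert0 Hausdorff_imp_t1_space openin_diff openin_subset subset_iff t1_space_closedin_singleton)

text \<open>
  The point \<open>z\<close> is kept outside both closures, which makes the union non-dense.
\<close>

lemma apart_inside:
  assumes A: "openin X A" "x \<in> A" and B: "openin X B" "y \<in> B" and z: "z \<in> topspace X"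
    and ne: "x \<noteq> y" "x \<noteq> z" "y \<noteq> z"
  obtains U V where "apart U V" "x \<in> U" "U \<subseteq> A" "y \<in> V" "V \<subseteq> B"
proof -
  obtain U where U: "U \<in> \<I>" "x \<in> U" "(X closure_of U) \<subseteq> A - {y} - {z}"
    using basis_shrink[of "A - {y} - {z}" x] A ne openin_remove_point by blast
  have "openin X (B - (X closure_of U) - {z})"
    using B openin_remove_point by (simp add: openin_diff)
  then obtain V where V: "V \<in> \<I>" "y \<in> V" "X closure_of V \<subseteq> B - (X closure_of U) - {z}"
    using basis_shrink[of "B - (X closure_of U) - {z}" y] B ne U(3) by blast
  have "z \<notin> X closure_of (U \<union> V)" using U V by (auto simp: closure_of_Un)
  then have "apart U V" unfolding apart_iff using U V z by (auto simp: disjnt_iff)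
  then show thesis using that U V basis_subset_closure by (metis Diff_subset subset_trans)
qed

lemma third_point: "\<exists>z\<in>topspace X. z \<noteq> x \<and> z \<noteq> y"
proof -
  obtain M N P where t: "[M, N, P] \<in> disjoint_tuples X \<I> 3"
    using weak_triple_transitivity[OF grp.one_closed grp.one_closed] by (elim exE conjE)
  note t' = triple_apart[OF t]
  have MN: "M \<in> \<I>" "N \<in> \<I>" "disjnt (X closure_of M) (X closure_of N)" using t' by (auto simp: apart_iff)
  obtain m n q where m: "m \<in> M" and n: "n \<in> N" and q: "q \<in> P" using nonempty[OF MN(1)] nonempty[OF MN(2)] nonempty[OF t'(2)] by blast
  have cl: "m \<in> X closure_of M" "n \<in> X closure_of N" "q \<in> X closure_of P"
    using m n q basis_subset_closure MN t'(2) by blast+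
  then have "m \<in> topspace X" "n \<in> topspace X" "q \<in> topspace X"
    using closure_of_subset_topspace by (metis subsetD)+
  moreover have "m \<noteq> n" "m \<noteq> q" "n \<noteq> q"
    using cl MN(3) t'(3,4) by (auto simp: disjnt_iff)
  ultimately show ?thesis by metis
qed

section \<open>Pointwise fixers of basic open sets\<close>

lemma fixer_subgroup:
  assumes "I \<subseteq> topspace X"
  shows "subgroup (fixer I) G"
proof (rule grp.subgroupI)
  show "fixer I \<subseteq> carrier G" by (auto simp: fixer_def)
  show "fixer I \<noteq> {}" using act_one assms by (auto simp: fixer_def)
  show "inv a \<in> fixer I" if "a \<in> fixer I" for a
  proof -
    have a: "a \<in> carrier G" "\<And>x. x \<in> I \<Longrightarrow> \<phi> a x = x" using that by (auto simp: fixer_def)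
    have "\<phi> (inv a) x = x" if "x \<in> I" for x
      using act_inv(1)[OF a(1), of x] a(2)[OF that] assms that by auto
    then show ?thesis using a(1) by (simp add: fixer_def)
  qed
  show "a \<otimes> b \<in> fixer I" if "a \<in> fixer I" "b \<in> fixer I" for a b
    using that composition_rule[of _ a b] assms by (auto simp: fixer_def)
qed

lemma fixer_image:
  assumes g: "g \<in> carrier G" and I: "I \<subseteq> topspace X"
  shows "fixer (\<phi> g ` I) = conjugate_set G g (fixer I)"
proof
  show "fixer (\<phi> g ` I) \<subseteq> conjugate_set G g (fixer I)"
  proof
    fix k assume k: "k \<in> fixer (\<phi> g ` I)"
    then have kG: "k \<in> carrier G" by (simp add: fixer_def)
    have "\<phi> (inv g \<otimes> k \<otimes> g) x = x" if x: "x \<in> I" for x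
    proof -
      have xX: "x \<in> topspace X" using x I by blast
      have "\<phi> (inv g \<otimes> k \<otimes> g) x = \<phi> (inv g) (\<phi> k (\<phi> g x))"
        using composition_rule[of x "inv g \<otimes> k" g] composition_rule[of "\<phi> g x" "inv g" k] g kG xX
        by (simp add: act_closed)
      also have "\<phi> k (\<phi> g x) = \<phi> g x" using k x by (simp add: fixer_def)
      finally show ?thesis using act_inv(1)[OF g xX] by simp
    qed
    then have "inv g \<otimes> k \<otimes> g \<in> fixer I" using g kG by (simp add: fixer_def)
    moreover have "k = g \<otimes> (inv g \<otimes> k \<otimes> g) \<otimes> inv g" using g kG by (simp add: grp.m_assoc[symmetric]) (simp add: grp.m_assoc)
    ultimately show "k \<in> conjugate_set G g (fixer I)" unfolding conjugate_set_def by blast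
  qed
  show "conjugate_set G g (fixer I) \<subseteq> fixer (\<phi> g ` I)"
  proof
    fix k assume "k \<in> conjugate_set G g (fixer I)"
    then obtain h where h: "h \<in> fixer I" and k: "k = g \<otimes> h \<otimes> inv g" by (auto simp: conjugate_set_def)
    have hG: "h \<in> carrier G" using h by (simp add: fixer_def)
    have "\<phi> k (\<phi> g x) = \<phi> g x" if x: "x \<in> I" for x
    proof -
      have xX: "x \<in> topspace X" using x I by blast
      have "\<phi> k (\<phi> g x) = \<phi> g (\<phi> h x)"
        using composition_rule[of "\<phi> g x" "g \<otimes> h" "inv g"] composition_rule[of x g h] g hG xX k
        by (simp add: act_closed act_inv)
      then show ?thesis using h x by (simp add: fixer_def)
    qed
    then show "k \<in> fixer (\<phi> g ` I)" using g hG k by (simp add: fixer_def)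
  qed
qed

lemma fixer_anti_mono: "I \<subseteq> J \<Longrightarrow> fixer J \<subseteq> fixer I"
  by (auto simp: fixer_def)

text \<open>
  An element of \<open>fixer I\<close> moves only points outside \<open>I\<close>, and keeps them outside. As \<open>I\<close> and \<open>J\<close> cover
  the space, the two supports are disjoint.
\<close>

lemma fixers_commute:
  assumes cover: "topspace X \<subseteq> I \<union> J" and h: "h \<in> fixer I" and k: "k \<in> fixer J"
  shows "h \<otimes> k = k \<otimes> h"
proof (rule act_ext)
  have hG: "h \<in> carrier G" and kG: "k \<in> carrier G" using h k by (auto simp: fixer_def)
  then show "h \<otimes> k \<in> carrier G" "k \<otimes> h \<in> carrier G" by auto
  fix x assume x: "x \<in> topspace X"
  \<comment> \<open>A point outside \<open>A\<close> cannot be moved into \<open>A\<close>, where \<open>g\<close> fixes everything.\<close>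
  have stay: "\<phi> g x \<notin> A" if "g \<in> fixer A" "x \<notin> A" for g A
  proof
    assume "\<phi> g x \<in> A"
    then have "\<phi> g (\<phi> g x) = \<phi> g x" using that by (simp add: fixer_def)
    then have "\<phi> g x = x"
      using act_inv(1)[of g] act_closed[of g x] that x unfolding fixer_def by (metis (no_types, lifting) mem_Collect_eq)
    then show False using \<open>\<phi> g x \<in> A\<close> that by simp
  qed
  have "\<phi> h (\<phi> k x) = \<phi> k (\<phi> h x)"
  proof (cases "x \<in> I \<and> x \<in> J")
    case True
    then show ?thesis using h k by (simp add: fixer_def)
  next
    case False
    then consider "x \<in> I" "x \<notin> J" | "x \<notin> I" "x \<in> J" using cover x by blast
    then show ?thesis
    proof cases
      case 1
      then have "\<phi> k x \<in> I" using stay[OF k] act_closed[OF kG x] cover by blast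
      then show ?thesis using h 1 by (simp add: fixer_def)
    next
      case 2
      then have "\<phi> h x \<in> J" using stay[OF h] act_closed[OF hG x] cover by blast
      then show ?thesis using k 2 by (simp add: fixer_def)
    qed
  qed
  then show "\<phi> (h \<otimes> k) x = \<phi> (k \<otimes> h) x" using composition_rule x hG kG by simp
qed

text \<open>
  Weak triple transitivity for \<open>g\<close> and \<open>\<one>\<close> gives \<open>k\<close> with \<open>k M = g M\<close> and \<open>k N = N\<close>. So
  \<open>k\<^sup>-\<^sup>1 g\<close> stabilizes \<open>M\<close> and \<open>k\<^sup>-\<^sup>1\<close> stabilizes \<open>N\<close>, and the local action property corrects \<open>k\<close> to
  an element \<open>c\<close> that agrees pointwise with \<open>g\<close> on \<open>M\<close> and with the identity on \<open>N\<close>. Then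
  \<open>g = c (c\<^sup>-\<^sup>1 g)\<close>.
\<close>

lemma factorization:
  assumes g: "g \<in> carrier G"
  obtains M N a b where "apart M N" "a \<in> fixer M" "b \<in> fixer N" "g = a \<otimes> b"
proof -
  obtain M N P where t: "[M, N, P] \<in> disjoint_tuples X \<I> 3"
    and "\<exists>k\<in>carrier G. \<phi> k ` M = \<phi> g ` M \<and> \<phi> k ` N = \<phi> \<one> ` N \<and> \<phi> k ` P = P"
    using weak_triple_transitivity[OF g grp.one_closed] by (elim exE conjE)
  then obtain k where k: "k \<in> carrier G"
    and kM: "\<phi> k ` M = \<phi> g ` M" and kN: "\<phi> k ` N = \<phi> \<one> ` N"
    by (elim bexE conjE)
  note t' = triple_apart[OF t]
  have X: "M \<subseteq> topspace X" "N \<subseteq> topspace X" using t'(1) basis_topspace by (auto simp: apart_iff)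
  have image_inv: "\<phi> (inv k) ` \<phi> k ` A = A" if "A \<subseteq> topspace X" for A
  proof -
    have "\<phi> (inv k) ` \<phi> k ` A = (\<lambda>x. x) ` A"
      unfolding image_image using act_inv(1)[OF k] that by (intro image_cong) auto
    then show ?thesis by simp
  qed
  have "\<phi> (inv k \<otimes> g) ` M = \<phi> (inv k) ` \<phi> g ` M"
    unfolding image_image using composition_rule[of _ "inv k" g] X g k by (intro image_cong) auto
  then have 1: "\<phi> (inv k \<otimes> g) ` M = M" using image_inv[OF X(1)] kM by simp
  have "\<phi> \<one> ` N = (\<lambda>x. x) ` N" using act_one X(2) by (intro image_cong) auto
  then have 2: "\<phi> (inv k) ` N = N" using image_inv[OF X(2)] kN by simp
  obtain b where b: "b \<in> carrier G" "\<forall>x\<in>M. \<phi> b x = \<phi> (inv k \<otimes> g) x" "\<forall>x\<in>N. \<phi> b x = \<phi> (inv k) x"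
    using local_action[OF t _ _ 1 2] g k by (metis grp.inv_closed grp.m_closed)
  define c where "c = k \<otimes> b"
  have c: "c \<in> carrier G" using k b by (simp add: c_def)
  have cM: "\<phi> c x = \<phi> g x" if x: "x \<in> M" for x
  proof -
    have xX: "x \<in> topspace X" using x X by blast
    have "\<phi> c x = \<phi> k (\<phi> (inv k) (\<phi> g x))"
      using composition_rule[OF xX k b(1)] b(2) x composition_rule[OF xX, of "inv k" g] g k
      by (simp add: c_def)
    then show ?thesis using act_inv(2)[OF k] act_closed[OF g xX] by simp
  qed
  have "c \<in> fixer N"
    using composition_rule[OF _ k b(1)] b(3) act_inv(2)[OF k] X(2) c
    by (auto simp: fixer_def c_def subset_iff)
  moreover have "\<phi> (inv c \<otimes> g) x = x" if x: "x \<in> M" for x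
  proof -
    have xX: "x \<in> topspace X" using x X by blast
    show ?thesis
      using composition_rule[OF xX, of "inv c" g] cM[OF x] act_inv(1)[OF c xX] c g by simp
  qed
  then have "inv c \<otimes> g \<in> fixer M" using c g by (simp add: fixer_def)
  moreover have "g = c \<otimes> (inv c \<otimes> g)" using c g by (simp add: grp.m_assoc[symmetric])
  ultimately show thesis using that apart_sym[OF t'(1)] by blast
qed

section \<open>Isolated points and chains of basic sets\<close>

text \<open>
  If \<open>x\<close> is isolated and \<open>y\<close> is another point, then \<open>{x}\<close> and some basic set \<open>V\<close> around \<open>y\<close> form a
  disjoint pair. Exchanging the two by double transitivity shows that \<open>V\<close> is a
  singleton. So the compact space \<open>X\<close> is discrete, hence finite, and \<open>G\<close> acts faithfully on it.
\<close>

lemma isolated_point_finite: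
  assumes x: "openin X {x}"
  shows "finite (carrier G)"
proof -
  have "openin X {y}" if y: "y \<in> topspace X" for y
  proof (cases "y = x")
    case False
    obtain z where z: "z \<in> topspace X" "z \<noteq> x" "z \<noteq> y" using third_point[of x y] by blast
    obtain U V where UV: "apart U V" "x \<in> U" "U \<subseteq> {x}" "y \<in> V" "V \<subseteq> topspace X"
      by (rule apart_inside[OF x singletonI openin_topspace y z(1) False[symmetric] z(2)[symmetric] z(3)[symmetric]])
    obtain g where "\<phi> g ` U = V"
      using double_transitivity[OF UV(1) apart_sym[OF UV(1)]] by (elim bexE conjE)
    moreover have "U = {x}" using UV by blast
    ultimately have "V = {y}" using UV(4) by blast
    moreover have "V \<in> \<I>" using UV(1) by (simp add: apart_iff)
    ultimately show ?thesis using basis_open by blast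
  qed (use x in simp)
  then have "X = discrete_topology (topspace X)" by (metis discrete_topology_unique)
  then have "finite (topspace X)" using compact by (metis compact_space_discrete_topology)
  then have "finite (topspace X \<rightarrow>\<^sub>E topspace X)" by (simp add: finite_PiE)
  moreover have "\<phi> ` carrier G \<subseteq> topspace X \<rightarrow>\<^sub>E topspace X"
    using bij_prop0 by (auto simp: Bij_def PiE_def bij_betw_def)
  ultimately have "finite (\<phi> ` carrier G)" by (rule rev_finite_subset)
  then show ?thesis using faithful by (rule finite_imageD)
qed

text \<open>
  The complement of the closure of \<open>I\<close> is open and, without isolated points, has room for a
  basic set and for a further point outside it.
\<close>

lemma exists_apart:
  assumes noiso: "\<And>x. \<not> openin X {x}" and I: "I \<in> \<I>"
  shows "\<exists>J. apart I J"
proof -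
  define V where "V = topspace X - (X closure_of I)"
  have V: "openin X V" by (simp add: V_def openin_diff)
  have "V \<noteq> {}" using nondense[OF I] closure_of_subset_topspace[of X I] by (auto simp: V_def)
  then obtain x where x: "x \<in> V" by blast
  have "V \<noteq> {x}" using V noiso[of x] by metis
  then obtain z where z: "z \<in> V" "z \<noteq> x" using x by blast
  obtain J where J: "J \<in> \<I>" "x \<in> J" "X closure_of J \<subseteq> V - {z}"
    using basis_shrink[OF openin_remove_point[OF V], of x z] x z by blast
  have "z \<notin> X closure_of (I \<union> J)" using J z by (auto simp: closure_of_Un V_def)
  moreover have "disjnt (X closure_of I) (X closure_of J)" using J by (auto simp: disjnt_iff V_def)
  ultimately have "apart I J" using I J z unfolding apart_iff V_def by blast
  then show ?thesis by blast
qed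

text \<open>
  Shrink \<open>I\<close> and \<open>I'\<close> to disjoint \<open>U\<close> and \<open>U'\<close> with non-dense union. The complement axiom applied to
  a small basic set that misses both gives \<open>J\<close> containing both.
\<close>

lemma basis_zigzag:
  assumes noiso: "\<And>x. \<not> openin X {x}" and I: "I \<in> \<I>" and I': "I' \<in> \<I>"
  shows "\<exists>U\<in>\<I>. \<exists>J\<in>\<I>. \<exists>U'\<in>\<I>. U \<subseteq> I \<and> U \<subseteq> J \<and> U' \<subseteq> J \<and> U' \<subseteq> I'"
proof -
  obtain x where x: "x \<in> I" using nonempty[OF I] by blast
  have "I' \<noteq> {x}" using noiso[of x] basis_open[OF I'] by metis
  then obtain y where y: "y \<in> I'" "y \<noteq> x" using nonempty[OF I'] by blast
  obtain z where z: "z \<in> topspace X" "z \<noteq> x" "z \<noteq> y" using third_point[of x y] by blast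
  obtain U U' where U: "apart U U'" "x \<in> U" "U \<subseteq> I" "y \<in> U'" "U' \<subseteq> I'"
    by (rule apart_inside[OF basis_open[OF I] x basis_open[OF I'] y(1) z(1)
          y(2)[symmetric] z(2)[symmetric] z(3)[symmetric]])
  define W where "W = topspace X - (X closure_of (U \<union> U'))"
  have "openin X W" unfolding W_def by (rule openin_diff[OF openin_topspace closedin_closure_of])
  moreover have "W \<noteq> {}"
    using U(1) closure_of_subset_topspace[of X "U \<union> U'"] by (auto simp: W_def apart_iff)
  ultimately obtain w where W: "openin X W" "w \<in> W" by blast
  obtain K where K: "K \<in> \<I>" "w \<in> K" "X closure_of K \<subseteq> W" by (rule basis_shrink[OF W])
  obtain J where J: "J \<in> \<I>" "topspace X - K \<subseteq> J" using complements[OF K(1)] by (elim bexE)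
  have UI: "U \<in> \<I>" "U' \<in> \<I>" using U by (auto simp: apart_iff)
  have "U \<union> U' \<subseteq> X closure_of (U \<union> U')"
    using basis_topspace[OF UI(1)] basis_topspace[OF UI(2)] by (intro closure_of_subset) blast
  then have "U \<union> U' \<subseteq> topspace X - K"
    using K(3) basis_subset_closure[OF K(1)] basis_topspace[OF UI(1)] basis_topspace[OF UI(2)]
    unfolding W_def by blast
  then show ?thesis using UI J U by blast
qed

end

section \<open>No actions of general type\<close>

lemma (in hyperbolic_action) finite_not_general_type:
  assumes "finite (carrier G)"
  shows "\<not> general_type G M d \<psi>"
proof -
  have "\<forall>g\<in>carrier G. d x (\<psi> g x) \<le> Max ((\<lambda>g. d x (\<psi> g x)) ` carrier G)" for x
    using assms by simp
  then have "bounded_orbits G M d \<psi>" unfolding bounded_orbits_def by blast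
  then show ?thesis using bounded_limit_set_empty by (simp add: general_type_def)
qed

theorem (in flexible_action) no_general_type_action:
  assumes "hyperbolic_action M d \<delta> G \<psi>"
  shows "\<not> general_type G M d \<psi>"
proof -
  interpret hyp: hyperbolic_action M d \<delta> G \<psi> by (rule assms)
  show ?thesis
  proof (cases "\<exists>x. openin X {x}")
    case True
    then show ?thesis using isolated_point_finite hyp.finite_not_general_type by blast
  next
    case False
    then have noiso: "\<not> openin X {x}" for x by blast
    define \<P> where "\<P> = {(fixer M, fixer N) |M N. apart M N}"
    show ?thesis
    proof (rule hyp.commuting_conjugates_not_general_type[of "fixer ` \<I>" \<P>])
      show "subgroup H G" if "H \<in> fixer ` \<I>" for H
        using that fixer_subgroup basis_topspace by blast
      show "\<P> \<subseteq> fixer ` \<I> \<times> fixer ` \<I>" unfolding \<P>_def apart_iff by blast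
      show "\<exists>g\<in>carrier G. H' = conjugate_set G g H \<and> K' = conjugate_set G g K"
        if HK: "(H, K) \<in> \<P>" "(H', K') \<in> \<P>" for H K H' K'
      proof -
        obtain M N where MN: "apart M N" "H = fixer M" "K = fixer N"
          using HK(1) unfolding \<P>_def by auto
        obtain M' N' where MN': "apart M' N'" "H' = fixer M'" "K' = fixer N'"
          using HK(2) unfolding \<P>_def by auto
        obtain g where g: "g \<in> carrier G" "\<phi> g ` M = M'" "\<phi> g ` N = N'"
          using double_transitivity[OF MN(1) MN'(1)] by (elim bexE conjE)
        have sub: "M \<subseteq> topspace X" "N \<subseteq> topspace X" using MN(1) basis_topspace by (auto simp: apart_iff)
        have "H' = conjugate_set G g H" "K' = conjugate_set G g K"
          unfolding MN(2,3) MN'(2,3)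
          using fixer_image[OF g(1) sub(1)] fixer_image[OF g(1) sub(2)] unfolding g(2,3) by this
        then show ?thesis using g(1) by blast
      qed
      show "\<exists>g\<in>carrier G. H' = conjugate_set G g H"
        if HH: "H \<in> fixer ` \<I>" "H' \<in> fixer ` \<I>" for H H'
      proof -
        obtain I I' where I: "I \<in> \<I>" "H = fixer I" and I': "I' \<in> \<I>" "H' = fixer I'" using HH by blast
        obtain J J' where J: "apart I J" and J': "apart I' J'"
          using exists_apart[OF noiso I(1)] exists_apart[OF noiso I'(1)] by (elim exE)
        obtain g where g: "g \<in> carrier G" "\<phi> g ` I = I'"
          using double_transitivity[OF J J'] by (elim bexE conjE)
        show ?thesis
          using fixer_image[OF g(1) basis_topspace[OF I(1)], unfolded g(2)] g(1) I(2) I'(2) by blast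
      qed
      show "\<exists>(H, K)\<in>\<P>. \<exists>a\<in>H. \<exists>b\<in>K. g = a \<otimes> b" if g: "g \<in> carrier G" for g
      proof -
        obtain M N a b where *: "apart M N" "a \<in> fixer M" "b \<in> fixer N" "g = a \<otimes> b"
          by (rule factorization[OF g])
        then have "(fixer M, fixer N) \<in> \<P>" unfolding \<P>_def by blast
        then show ?thesis using * by blast
      qed
      show "\<exists>K\<in>fixer ` \<I>. \<forall>h\<in>H. \<forall>k\<in>K. h \<otimes> k = k \<otimes> h" if H: "H \<in> fixer ` \<I>" for H
      proof -
        obtain I where I: "I \<in> \<I>" "H = fixer I" using H by blast
        obtain J where J: "J \<in> \<I>" "topspace X - I \<subseteq> J" using complements[OF I(1)] by (elim bexE)
        then have "topspace X \<subseteq> I \<union> J" by blast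
        then have "\<forall>h\<in>H. \<forall>k\<in>fixer J. h \<otimes> k = k \<otimes> h" using fixers_commute I(2) by blast
        then show ?thesis using J(1) by blast
      qed
      show "\<exists>U\<in>fixer ` \<I>. \<exists>J\<in>fixer ` \<I>. \<exists>U'\<in>fixer ` \<I>. H \<subseteq> U \<and> J \<subseteq> U \<and> J \<subseteq> U' \<and> H' \<subseteq> U'"
        if HH: "H \<in> fixer ` \<I>" "H' \<in> fixer ` \<I>" for H H'
      proof -
        obtain I I' where I: "I \<in> \<I>" "H = fixer I" and I': "I' \<in> \<I>" "H' = fixer I'" using HH by blast
        obtain U J U' where *: "U \<in> \<I>" "J \<in> \<I>" "U' \<in> \<I>" "U \<subseteq> I" "U \<subseteq> J" "U' \<subseteq> J" "U' \<subseteq> I'"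
          using basis_zigzag[OF noiso I(1) I'(1)] by (elim bexE conjE)
        show ?thesis
          by (rule bexI[of _ "fixer U"], rule bexI[of _ "fixer J"], rule bexI[of _ "fixer U'"])
            (use * I I' fixer_anti_mono in simp_all)
      qed
    qed
  qed
qed

theorem theorem5p1:
  fixes G :: "('g, 'm) monoid_scheme"
    and X :: "'x topology"
    and \<phi> :: "'g \<Rightarrow> 'x \<Rightarrow> 'x"
    and \<I> :: "'x set set"
  assumes compact: "compact_space X"
    and Hausdorff: "Hausdorff_space X"
    and faithful: "faithful_action G (topspace X) \<phi>"
    and homeo: "\<And>g. g \<in> carrier G \<Longrightarrow> homeomorphic_map X X (\<phi> g)"
    and basis: "openin X = arbitrary union_of (\<lambda>U. U \<in> \<I>)"
    and nonempty: "\<And>I. I \<in> \<I> \<Longrightarrow> I \<noteq> {}"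
    and nondense: "\<And>I. I \<in> \<I> \<Longrightarrow> X closure_of I \<noteq> topspace X"
    and complements: "\<And>I. I \<in> \<I> \<Longrightarrow> \<exists>J\<in>\<I>. topspace X - I \<subseteq> J"
    and preserves: "\<And>g I. g \<in> carrier G \<Longrightarrow> I \<in> \<I> \<Longrightarrow> \<phi> g ` I \<in> \<I>"
    and double_transitivity:
      "\<And>I J I' J'. [I, J] \<in> disjoint_tuples X \<I> 2 \<Longrightarrow> [I', J'] \<in> disjoint_tuples X \<I> 2 \<Longrightarrow>
         \<exists>g\<in>carrier G. \<phi> g ` I = I' \<and> \<phi> g ` J = J'"
    and weak_triple_transitivity:
      "\<And>g h. g \<in> carrier G \<Longrightarrow> h \<in> carrier G \<Longrightarrow>
         \<exists>M N P. [M, N, P] \<in> disjoint_tuples X \<I> 3 \<and>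
           [\<phi> g ` M, \<phi> h ` N, P] \<in> disjoint_tuples X \<I> 3 \<and>
           (\<exists>k\<in>carrier G. \<phi> k ` M = \<phi> g ` M \<and> \<phi> k ` N = \<phi> h ` N \<and> \<phi> k ` P = P)"
    and local_action:
      "\<And>I J K g h. [I, J, K] \<in> disjoint_tuples X \<I> 3 \<Longrightarrow> g \<in> carrier G \<Longrightarrow> h \<in> carrier G \<Longrightarrow>
         \<phi> g ` I = I \<Longrightarrow> \<phi> h ` J = J \<Longrightarrow>
         \<exists>b\<in>carrier G. (\<forall>x\<in>I. \<phi> b x = \<phi> g x) \<and> (\<forall>x\<in>J. \<phi> b x = \<phi> h x) \<and> (\<forall>x\<in>K. \<phi> b x = x)"
  shows "property_NGT TYPE('y) G"
proof -
  have "flexible_action G X \<phi> \<I>"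
    by (rule flexible_action.intro[OF faithful], rule flexible_action_axioms.intro)
      (fact compact Hausdorff basis nonempty nondense complements double_transitivity
        weak_triple_transitivity local_action)+
  then interpret act: flexible_action G X \<phi> \<I> .
  show ?thesis
    unfolding property_NGT_def
  proof (intro notI, elim exE conjE)
    fix M :: "'y set" and d \<psi>
    assume hyp: "hyperbolic_space M d" and iso: "isometric_action G M d \<psi>"
      and gt: "general_type G M d \<psi>"
    have metric: "Metric_space M d" using hyp by (simp add: hyperbolic_space_def)
    obtain \<delta> where \<delta>: "\<forall>p\<in>M. \<forall>x\<in>M. \<forall>y\<in>M. \<forall>z\<in>M.
        min (gromov_product d p x y) (gromov_product d p y z) - \<delta> \<le> gromov_product d p x z"
      using hyp unfolding hyperbolic_space_def gromov_hyperbolic_def by blast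
    \<comment> \<open>For empty \<open>M\<close> the constant \<open>\<delta>\<close> may be negative.\<close>
    have "min (gromov_product d p x y) (gromov_product d p y z) - max \<delta> 0 \<le> gromov_product d p x z"
      if "p \<in> M" "x \<in> M" "y \<in> M" "z \<in> M" for p x y z
      using \<delta>[rule_format, OF that] by linarith
    then have "hyperbolic_metric M d (max \<delta> 0)"
      by (intro hyperbolic_metric.intro[OF metric] hyperbolic_metric_axioms.intro) simp_all
    moreover have "group_action G M \<psi>" "hyperbolic_action_axioms M d G \<psi>"
      using iso by (auto simp: isometric_action_def hyperbolic_action_axioms_def)
    ultimately have "hyperbolic_action M d (max \<delta> 0) G \<psi>"
      by (rule hyperbolic_action.intro)
    then show False using act.no_general_type_action gt by blast
  qed
qed

end
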